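(* Let $n\ge 2$, let $\mathcal{G}$ be a connected weighted undirected graph on $n$ vertices with Laplacian matrix $L$, let $\lambda_2$ be the minimum non-zero eigenvalue of $L$, and let $\alpha,\beta>0$ be real constants. Let $T_1(s)$ be the transfer matrix from $\omega$ to $y$ of the closed-loop multi-agent system with the absolute velocity protocol $$\begin{bmatrix} \dot x(t) \\ \dot v(t) \end{bmatrix}=\begin{bmatrix} \mathbf{0} & I_n \\ -\alpha L & -\beta I_n \end{bmatrix}\begin{bmatrix} x(t) \\ v(t) \end{bmatrix}+\begin{bmatrix} \mathbf{0} \\ I_n \end{bmatrix}\omega(t),\qquad y(t)=\begin{bmatrix} \Phi_n & \mathbf{0} \\ \mathbf{0} & \Phi_n \end{bmatrix}\begin{bmatrix} x(t) \\ v(t) \end{bmatrix},$$ where $\Phi_n=I_n-\frac1n\mathbf{1}_n\mathbf{1}_n^{\top}$. Then $$\|T_1(s)\|_\infty=\begin{cases} \dfrac{1}{\sqrt{(\alpha\lambda_2)^2-\Big[\sqrt{(\alpha\lambda_2+1)^2-\beta^2}-1\Big]^2}}, & \text{if } 0<\beta<\sqrt{(\alpha\lambda_2)^2+2\alpha\lambda_2}, \\[3ex] \dfrac{1}{\alpha\lambda_2}, & \text{if } \beta\ge\sqrt{(\alpha\lambda_2)^2+2\alpha\lambda_2}. \end{cases}$$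
   Context: Graph: a weighted undirected graph on vertices $1,\dots,n$ is given by a symmetric weighted adjacency matrix $\mathcal{A}=[a_{ij}]\in\mathbb{R}^{n\times n}$ with $a_{ij}=a_{ji}\ge 0$ and $a_{ii}=0$; there is an edge between $i$ and $j$ iff $a_{ij}>0$. It is connected if any two distinct vertices are joined by a path. The Laplacian $L=[l_{ij}]$ has $l_{ii}=\sum_{j\ne i}a_{ij}$ and $l_{ij}=-a_{ij}$ for $j\neq i$. For a connected graph the eigenvalues of $L$ are $0=\lambda_1<\lambda_2\le\cdots\le\lambda_n$. System: the agents satisfy $\dot x_i=v_i$, $\dot v_i=u_i+\omega_i$ ($i=1,\dots,n$), with disturbance $\omega_i\in\mathcal{L}_2[0,\infty)$ and absolute velocity protocol $u_i=\alpha\sum_{j=1}^n a_{ij}(x_j-x_i)-\beta v_i$. The output $y$ stacks the consensus errors $x_i-\frac1n\sum_j x_j$ and $v_i-\frac1n\sum_j v_j$. This gives the displayed system with $x=[x_1,\dots,x_n]^\top$, $v=[v_1,\dots,v_n]^\top$, $\omega=[\omega_1,\dots,\omega_n]^\top$. Here $\mathbf{1}_n$ is the all-ones column vector and $I_n$ the identity matrix. Transfer matrix and norm: for a system $\dot z=Az+B\omega$, $y=Cz$, the transfer matrix is the matrix of rational functions $T(s)=C(sI-A)^{-1}B$ (common factors cancelled; the mode of $A$ along the consensus direction, which is not asymptotically stable, is unobservable from $y$ and so contributes no poles to $T$). Its $H_\infty$ norm is $\|T(s)\|_\infty=\sup_{\upsilon\in\mathbb{R}}\sigma_{\max}[T(\mathbf{j}\upsilon)]$,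 where $\mathbf{j}$ is the imaginary unit and $\sigma_{\max}$ is the maximum singular value. *)

theory Defs
  imports
    "HOL-Computational_Algebra.Normalized_Fraction"
    "HOL-Computational_Algebra.Polynomial_Factorial"
    "HOL-Computational_Algebra.Field_as_Ring"
    "HOL-Library.Extended_Real"
    "Jordan_Normal_Form.Spectral_Radius"
    "Jordan_Normal_Form.Schur_Decomposition"
    "Jordan_Normal_Form.Gauss_Jordan_Elimination"
begin

definition weighted_graph :: "nat \<Rightarrow> real mat \<Rightarrow> bool" where
  "weighted_graph n W \<longleftrightarrow> W \<in> carrier_mat n n \<and>
     (\<forall>i<n. \<forall>j<n. W $$ (i,j) = W $$ (j,i) \<and> W $$ (i,j) \<ge> 0) \<and> (\<forall>i<n. W $$ (i,i) = 0)"

definition edges :: "nat \<Rightarrow> real mat \<Rightarrow> (nat \<times> nat) set" where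
  "edges n W = {(i,j). i < n \<and> j < n \<and> W $$ (i,j) > 0}"

definition connected_graph :: "nat \<Rightarrow> real mat \<Rightarrow> bool" where
  "connected_graph n W \<longleftrightarrow> (\<forall>i<n. \<forall>j<n. i \<noteq> j \<longrightarrow> (i,j) \<in> (edges n W)\<^sup>*)"

definition laplacian :: "nat \<Rightarrow> real mat \<Rightarrow> real mat" where
  "laplacian n W = mat n n (\<lambda>(i,j). if i = j then (\<Sum>k\<in>{0..<n} - {i}. W $$ (i,k)) else - W $$ (i,j))"

definition min_nonzero_eigenvalue :: "real mat \<Rightarrow> real" where
  "min_nonzero_eigenvalue M = Min {k. eigenvalue M k \<and> k \<noteq> 0}"

text \<open>Rational functions in \<open>s\<close> are elements of the field of fractions \<^typ>\<open>complex poly fract\<close>.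
  Since \<open>char_poly_matrix A\<close> is \<open>s I - A\<close>, which is invertible over this field
  (lemma \<open>mat_inverse_resolvent\<close> below), the inverse in the next definition is always a genuine one.\<close>

definition const_mat :: "real mat \<Rightarrow> complex poly fract mat" where
  "const_mat M = map_mat (\<lambda>a. to_fract [:complex_of_real a:]) M"

definition transfer_matrix :: "real mat \<Rightarrow> real mat \<Rightarrow> real mat \<Rightarrow> complex poly fract mat" where
  "transfer_matrix A B C =
     const_mat C
       * the (mat_inverse (map_mat to_fract (char_poly_matrix (map_mat complex_of_real A))))
       * const_mat B"

text \<open>\<open>quot_of_fract\<close> yields coprime numerator and denominator, so common factors are
  cancelled before a point is substituted.\<close>

definition eval_ratfun :: "complex poly fract \<Rightarrow> complex \<Rightarrow> complex" where
  "eval_ratfun f z = poly (fst (quot_of_fract f)) z / poly (snd (quot_of_fract f)) z"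

definition eval_tf :: "complex poly fract mat \<Rightarrow> complex \<Rightarrow> complex mat" where
  "eval_tf T z = map_mat (\<lambda>f. eval_ratfun f z) T"

definition singular_values :: "complex mat \<Rightarrow> real set" where
  "singular_values M = {\<sigma>. \<sigma> \<ge> 0 \<and> eigenvalue (mat_adjoint M * M) (complex_of_real (\<sigma>\<^sup>2))}"

definition sigma_max :: "complex mat \<Rightarrow> real" where
  "sigma_max M = Max (singular_values M)"

text \<open>The supremum is taken in \<^typ>\<open>ereal\<close>, so that an unbounded \<open>T\<close> has norm \<open>\<infinity>\<close>. The junk value
  of \<open>eval_ratfun\<close> at a pole on the imaginary axis is harmless: \<open>T\<close> is then unbounded near it.\<close>

definition hinf_norm :: "complex poly fract mat \<Rightarrow> ereal" where
  "hinf_norm T = (SUP \<upsilon>::real. ereal (sigma_max (eval_tf T (\<i> * complex_of_real \<upsilon>))))"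

definition consensus_proj :: "nat \<Rightarrow> real mat" where
  "consensus_proj n = 1\<^sub>m n - (1 / real n) \<cdot>\<^sub>m mat n n (\<lambda>_. 1)"

definition abs_vel_state_mat :: "nat \<Rightarrow> real \<Rightarrow> real \<Rightarrow> real mat \<Rightarrow> real mat" where
  "abs_vel_state_mat n \<alpha> \<beta> L =
     four_block_mat (0\<^sub>m n n) (1\<^sub>m n) ((- \<alpha>) \<cdot>\<^sub>m L) ((- \<beta>) \<cdot>\<^sub>m 1\<^sub>m n)"

definition input_mat :: "nat \<Rightarrow> real mat" where
  "input_mat n = 0\<^sub>m n n @\<^sub>r 1\<^sub>m n"

definition output_mat :: "nat \<Rightarrow> real mat" where
  "output_mat n = four_block_mat (consensus_proj n) (0\<^sub>m n n) (0\<^sub>m n n) (consensus_proj n)"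

definition T1 :: "nat \<Rightarrow> real mat \<Rightarrow> real \<Rightarrow> real \<Rightarrow> complex poly fract mat" where
  "T1 n W \<alpha> \<beta> =
     transfer_matrix (abs_vel_state_mat n \<alpha> \<beta> (laplacian n W)) (input_mat n) (output_mat n)"

lemma mat_inverse_resolvent:
  fixes M :: "complex mat"
  assumes M: "M \<in> carrier_mat n n"
  shows "\<exists>R. mat_inverse (map_mat to_fract (char_poly_matrix M)) = Some R
    \<and> R \<in> carrier_mat n n
    \<and> map_mat to_fract (char_poly_matrix M) * R = 1\<^sub>m n
    \<and> R * map_mat to_fract (char_poly_matrix M) = 1\<^sub>m n"
proof -
  let ?N = "map_mat to_fract (char_poly_matrix M)"
  interpret h: comm_ring_hom "to_fract :: complex poly \<Rightarrow> complex poly fract"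
    by unfold_locales auto
  have N: "?N \<in> carrier_mat n n"
    using M by simp
  have "char_poly M \<noteq> 0"
    using degree_monic_char_poly[OF M] by (metis coeff_0 zero_neq_one)
  then have "det ?N \<noteq> 0"
    by (simp add: h.hom_det char_poly_def[symmetric])
  then have "?N \<in> Units (ring_mat TYPE(complex poly fract) n ())"
    by (rule det_non_zero_imp_unit[OF N])
  then obtain R where R: "mat_inverse ?N = Some R"
    using mat_inverse(1)[OF N, where b = "()"] by (cases "mat_inverse ?N") auto
  with mat_inverse(2)[OF N R] show ?thesis by blast
qed

lemma eval_ratfun_Fract:
  assumes "poly q z \<noteq> 0"
  shows "eval_ratfun (Fract p q) z = poly p z / poly q z"
proof -
  define a b where "a = fst (quot_of_fract (Fract p q))" and "b = snd (quot_of_fract (Fract p q))"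
  have q: "q \<noteq> 0" using assms by auto
  have b: "b \<noteq> 0" by (simp add: b_def)
  have "Fract a b = Fract p q"
    by (simp add: a_def b_def)
  then have eq: "a * q = p * b"
    using q b by (simp add: eq_fract)
  have "coprime a b"
    unfolding a_def b_def by (rule coprime_quot_of_fract)
  moreover have "b dvd a * q" by (simp add: eq)
  ultimately have "b dvd q"
    by (simp add: coprime_dvd_mult_right_iff coprime_commute)
  then have "poly b z \<noteq> 0" using assms by (auto elim!: dvdE)
  moreover have "poly a z * poly q z = poly p z * poly b z"
    using arg_cong[OF eq, of "\<lambda>r. poly r z"] by simp
  ultimately show ?thesis
    using assms by (simp add: eval_ratfun_def a_def[symmetric] b_def[symmetric] frac_eq_eq)
qed

end

theory Submission
  imports Defs
begin

text \<open>The transfer matrix satisfies \<open>T(s) D(s) = [\<Phi>; s \<Phi>]\<close> with \<open>D(s) = \<alpha> L + (s\<^sup>2 + \<beta> s) I\<close>. Since \<open>T\<close> annihilates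
  the consensus direction, the averaging matrix \<open>J\<close> may be added to \<open>D\<close>, which makes \<open>D + J\<close> invertible on
  the whole imaginary axis. Hence \<open>\<sigma>\<^sub>m\<^sub>a\<^sub>x[T(\<i> \<omega>)]\<^sup>2\<close> is the largest value of \<open>(1 + \<omega>\<^sup>2) |p|\<^sup>2 / |D(\<i> \<omega>) p|\<^sup>2\<close>
  over \<open>p\<close> orthogonal to the constants. On that space \<open>L \<ge> \<lambda>\<^sub>2\<close>, and completing a square shows that the
  quotient is at most the maximum over \<open>\<omega>\<close> of the gain of the \<open>\<lambda>\<^sub>2\<close> mode, a one-variable problem;
  an eigenvector for \<open>\<lambda>\<^sub>2\<close> attains it.\<close>

subsection \<open>Symmetric matrices with nonnegative eigenvalues\<close>

text \<open>Two obstacles shape the argument. The closed-loop state matrix A is singular, so s I - A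
  cannot be inverted at s = 0 although T has no pole there. All cancellation therefore takes place
  among rational functions, and only the resulting linear equation for T is evaluated. Adding J
  turns the factor s^2 + \<beta> s of the consensus direction into 1 + s^2 + \<beta> s, which has no
  zero on the imaginary axis. Moreover, \<open>sigma_max\<close> is defined through eigenvalues of
  T* T, and no spectral theorem is invoked. For the upper bound a norm inequality applied to each
  eigenvector is enough. For attainment a large ratio |T v| / |v| would not do: v has to be shown to
  be an exact eigenvector of T* T.\<close>

lemma smult_mult_mat_vec:
  assumes "A \<in> carrier_mat nr nc" "v \<in> carrier_vec nc"
  shows "(c \<cdot>\<^sub>m A) *\<^sub>v v = c \<cdot>\<^sub>v (A *\<^sub>v (v :: 'a :: comm_semiring_0 vec))"
  using assms by (intro eq_vecI) (auto simp: scalar_prod_def sum_distrib_left mult.assoc)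

lemma det_nonzero_inverse:
  fixes A :: "'a :: field mat"
  assumes "A \<in> carrier_mat n n" "det A \<noteq> 0"
  obtains B where "B \<in> carrier_mat n n" "A * B = 1\<^sub>m n" "B * A = 1\<^sub>m n"
  using det_non_zero_imp_unit[OF assms, of "()"] by (auto simp: Units_def ring_mat_def)

lemma scalar_prod_self_nonneg: "(x :: real vec) \<bullet> x \<ge> 0"
  by (auto simp: scalar_prod_def intro: sum_nonneg)

lemma scalar_prod_self_eq_0:
  assumes "x \<in> carrier_vec n" "(x :: real vec) \<bullet> x = 0"
  shows "x = 0\<^sub>v n"
  using assms conjugate_square_eq_0_vec[of x n] by simp

text \<open>Since |x_i x_j| <= x . x for all i and j, the sum of the absolute entries serves as the
  constant. One is added so that it is positive even for the zero matrix, because a step of size 1 /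
  C is taken later.\<close>

lemma quadratic_form_bounded:
  fixes B :: "real mat"
  assumes B: "B \<in> carrier_mat n n"
  obtains C where "C > 0" "\<And>x. x \<in> carrier_vec n \<Longrightarrow> x \<bullet> (B *\<^sub>v x) \<le> C * (x \<bullet> x)"
proof
  let ?C = "(\<Sum>i<n. \<Sum>j<n. \<bar>B $$ (i,j)\<bar>)"
  show "?C + 1 > 0"
    by (smt (verit) abs_ge_zero sum_nonneg)
  fix x :: "real vec"
  assume x: "x \<in> carrier_vec n"
  have sq: "(x $ i)\<^sup>2 \<le> x \<bullet> x" if "i < n" for i
    using member_le_sum[of i "{0..<n}" "\<lambda>i. (x $ i)\<^sup>2"] that x
    by (auto simp: scalar_prod_def power2_eq_square)
  have "x \<bullet> (B *\<^sub>v x) = (\<Sum>i<n. \<Sum>j<n. B $$ (i,j) * (x $ i * x $ j))"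
    using B x by (auto simp: scalar_prod_def sum_distrib_left mult_ac lessThan_atLeast0 intro!: sum.cong)
  also have "\<dots> \<le> (\<Sum>i<n. \<Sum>j<n. \<bar>B $$ (i,j)\<bar> * (x \<bullet> x))"
  proof (intro sum_mono)
    fix i j assume "i \<in> {..<n}" "j \<in> {..<n}"
    then have "(x $ i)\<^sup>2 \<le> x \<bullet> x" "(x $ j)\<^sup>2 \<le> x \<bullet> x" using sq by auto
    moreover have "(\<bar>x $ i\<bar> - \<bar>x $ j\<bar>)\<^sup>2 \<ge> 0" by simp
    ultimately have "\<bar>x $ i * x $ j\<bar> \<le> x \<bullet> x"
      by (simp add: power2_diff abs_mult)
    then have "\<bar>B $$ (i,j)\<bar> * \<bar>x $ i * x $ j\<bar> \<le> \<bar>B $$ (i,j)\<bar> * (x \<bullet> x)"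
      by (intro mult_left_mono) auto
    then show "B $$ (i,j) * (x $ i * x $ j) \<le> \<bar>B $$ (i,j)\<bar> * (x \<bullet> x)"
      by (metis abs_ge_self abs_mult order_trans)
  qed
  also have "\<dots> = ?C * (x \<bullet> x)" by (simp add: sum_distrib_right)
  also have "\<dots> \<le> (?C + 1) * (x \<bullet> x)"
    using scalar_prod_self_nonneg[of x] by (simp add: algebra_simps)
  finally show "x \<bullet> (B *\<^sub>v x) \<le> (?C + 1) * (x \<bullet> x)" .
qed

text \<open>If the shifts \<open>c\<close> making \<open>A + c I\<close> positive semidefinite had a positive infimum \<open>c\<close>, then \<open>A + c I\<close>
  would be semidefinite and invertible, hence bounded below by a positive multiple of \<open>I\<close>,
  and \<open>c\<close> could be decreased further.\<close>

lemma psd_if_eigenvalues_nonneg: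
  fixes A :: "real mat"
  assumes A: "A \<in> carrier_mat n n"
    and sym: "\<And>x y. x \<in> carrier_vec n \<Longrightarrow> y \<in> carrier_vec n \<Longrightarrow> x \<bullet> (A *\<^sub>v y) = y \<bullet> (A *\<^sub>v x)"
    and ev: "\<And>k. eigenvalue A k \<Longrightarrow> k \<ge> 0"
    and x: "x \<in> carrier_vec n"
  shows "x \<bullet> (A *\<^sub>v x) \<ge> 0"
proof (rule ccontr)
  assume neg: "\<not> x \<bullet> (A *\<^sub>v x) \<ge> 0"
  define S where "S = {c. \<forall>y\<in>carrier_vec n. 0 \<le> y \<bullet> (A *\<^sub>v y) + c * (y \<bullet> y)}"
  obtain C0 where C0: "\<And>y. y \<in> carrier_vec n \<Longrightarrow> y \<bullet> ((- A) *\<^sub>v y) \<le> C0 * (y \<bullet> y)"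
    using quadratic_form_bounded[of "- A" n] A by (metis uminus_carrier_mat)
  have "C0 \<in> S"
    unfolding S_def using C0 A by force
  then have S_ne: "S \<noteq> {}" by auto
  have "x \<bullet> x \<noteq> 0"
    using scalar_prod_self_eq_0[OF x] neg A x by auto
  then have xx: "x \<bullet> x > 0" using scalar_prod_self_nonneg[of x] by simp
  \<comment> \<open>The negated Rayleigh quotient at x: the condition at x alone already forces
    every admissible shift to be at least this positive number.\<close>
  define c1 where "c1 = - (x \<bullet> (A *\<^sub>v x)) / (x \<bullet> x)"
  have c1: "c1 > 0" using neg xx by (simp add: c1_def field_simps)
  have lower: "c1 \<le> c" if "c \<in> S" for c
    using that x xx by (auto simp: S_def c1_def field_simps)
  then have bdd: "bdd_below S" by (meson bdd_below.I)
  define c where "c = Inf S"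
  have cpos: "c > 0"
    using cInf_greatest[OF S_ne lower] c1 by (simp add: c_def)
  \<comment> \<open>The infimum is itself admissible, because for each fixed y the condition is just
    a lower bound on the shift.\<close>
  have psd: "0 \<le> y \<bullet> (A *\<^sub>v y) + c * (y \<bullet> y)" if y: "y \<in> carrier_vec n" for y
  proof (cases "y \<bullet> y = 0")
    case True
    then show ?thesis using scalar_prod_self_eq_0[OF y] A y by auto
  next
    case False
    then have yy: "y \<bullet> y > 0" using scalar_prod_self_nonneg[of y] by simp
    have "- (y \<bullet> (A *\<^sub>v y)) / (y \<bullet> y) \<le> c"
      unfolding c_def using y yy by (intro cInf_greatest[OF S_ne]) (auto simp: S_def field_simps)
    then show ?thesis using yy by (simp add: field_simps)
  qed
  define M where "M = A + c \<cdot>\<^sub>m 1\<^sub>m n"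
  have M: "M \<in> carrier_mat n n" using A by (simp add: M_def)
  have Mv: "M *\<^sub>v y = A *\<^sub>v y + c \<cdot>\<^sub>v y" if y: "y \<in> carrier_vec n" for y
    using A y by (simp add: M_def add_mult_distrib_mat_vec[of _ n n] smult_mult_mat_vec[of _ n n])
  have "det M \<noteq> 0"
  proof
    assume "det M = 0"
    then obtain v where v: "v \<in> carrier_vec n" "v \<noteq> 0\<^sub>v n" "M *\<^sub>v v = 0\<^sub>v n"
      using det_0_iff_vec_prod_zero[OF M] by auto
    have "A *\<^sub>v v = (- c) \<cdot>\<^sub>v v"
    proof (rule eq_vecI)
      fix i assume "i < dim_vec ((- c) \<cdot>\<^sub>v v)"
      then show "(A *\<^sub>v v) $ i = ((- c) \<cdot>\<^sub>v v) $ i"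
        using arg_cong[OF v(3)[unfolded Mv[OF v(1)]], of "\<lambda>u. u $ i"] v(1) A by auto
    qed (use A v in auto)
    then have "eigenvalue A (- c)"
      using v A by (auto simp: eigenvalue_def eigenvector_def intro!: exI[of _ v])
    then show False using ev cpos by force
  qed
  then obtain B where B: "B \<in> carrier_mat n n" "M * B = 1\<^sub>m n"
    using det_nonzero_inverse[OF M] by blast
  obtain C where C: "C > 0" "\<And>y. y \<in> carrier_vec n \<Longrightarrow> y \<bullet> (B *\<^sub>v y) \<le> C * (y \<bullet> y)"
    using quadratic_form_bounded[OF B(1)] by blast
  \<comment> \<open>Semidefiniteness of M at y - t B y, with B the inverse of M, gives y . M y >= 2
    t (y . y) - t^2 (y . B y). As y . B y <= C (y . y), the choice t = 1 / C leaves y . M y >= t (y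
    . y).\<close>
  have "c - 1 / C \<in> S"
    unfolding S_def
  proof (intro CollectI ballI)
    fix y :: "real vec" assume y: "y \<in> carrier_vec n"
    let ?z = "B *\<^sub>v y" and ?t = "1 / C"
    have z: "?z \<in> carrier_vec n" using B y by simp
    have Mz: "M *\<^sub>v ?z = y" using B M y by (simp flip: assoc_mult_mat_vec)
    have "0 \<le> (y - ?t \<cdot>\<^sub>v ?z) \<bullet> (M *\<^sub>v (y - ?t \<cdot>\<^sub>v ?z))"
      using psd[of "y - ?t \<cdot>\<^sub>v ?z"] y z A by (simp add: Mv scalar_prod_add_distrib[of _ n])
    also have "M *\<^sub>v (y - ?t \<cdot>\<^sub>v ?z) = M *\<^sub>v y - ?t \<cdot>\<^sub>v y"
      using M y z by (simp add: mult_minus_distrib_mat_vec[of _ n n] mult_mat_vec Mz)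
    also have "(y - ?t \<cdot>\<^sub>v ?z) \<bullet> \<dots> = y \<bullet> (M *\<^sub>v y) - ?t * (y \<bullet> y) - ?t * (?z \<bullet> (M *\<^sub>v y)) + ?t\<^sup>2 * (?z \<bullet> y)"
      using M y z by (simp add: scalar_prod_minus_distrib[of _ n] minus_scalar_prod_distrib[of _ n] algebra_simps power2_eq_square)
    also have "?z \<bullet> (M *\<^sub>v y) = y \<bullet> (M *\<^sub>v ?z)"
      using y z A sym[OF y z] by (simp add: Mv scalar_prod_add_distrib[of _ n] comm_scalar_prod[of y n])
    also have "y \<bullet> (M *\<^sub>v ?z) = y \<bullet> y" by (simp add: Mz)
    also have "?z \<bullet> y = y \<bullet> ?z" using y z by (rule comm_scalar_prod[symmetric])
    finally have "0 \<le> y \<bullet> (M *\<^sub>v y) - 2 * ?t * (y \<bullet> y) + ?t\<^sup>2 * (y \<bullet> ?z)" by simp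
    also have "\<dots> \<le> y \<bullet> (M *\<^sub>v y) - 2 * ?t * (y \<bullet> y) + ?t\<^sup>2 * (C * (y \<bullet> y))"
      using C(2)[OF y] by (intro add_left_mono mult_left_mono) auto
    also have "\<dots> = y \<bullet> (M *\<^sub>v y) - ?t * (y \<bullet> y)"
      using C(1) by (simp add: power2_eq_square field_simps)
    also have "\<dots> = y \<bullet> (A *\<^sub>v y) + (c - ?t) * (y \<bullet> y)"
      using y A by (simp add: Mv scalar_prod_add_distrib[of _ n] algebra_simps)
    finally show "0 \<le> y \<bullet> (A *\<^sub>v y) + (c - ?t) * (y \<bullet> y)" .
  qed
  then have "c \<le> c - 1 / C"
    unfolding c_def using bdd by (rule cInf_lower)
  then show False using C(1) by (simp add: field_simps)
qed

subsection \<open>The Laplacian and its spectral gap\<close>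

lemma zero_mat_mult_vec [simp]:
  "v \<in> carrier_vec nc \<Longrightarrow> 0\<^sub>m nr nc *\<^sub>v (v :: 'a :: semiring_0 vec) = 0\<^sub>v nr"
  by (intro eq_vecI) (auto simp: scalar_prod_def)

lemma symmetric_quadratic_form:
  fixes A :: "real mat"
  assumes A: "A \<in> carrier_mat n n"
    and sym: "\<And>i j. i < n \<Longrightarrow> j < n \<Longrightarrow> A $$ (i,j) = A $$ (j,i)"
    and x: "x \<in> carrier_vec n" and y: "y \<in> carrier_vec n"
  shows "x \<bullet> (A *\<^sub>v y) = y \<bullet> (A *\<^sub>v x)"
proof -
  have "x \<bullet> (A *\<^sub>v y) = (\<Sum>i<n. \<Sum>j<n. A $$ (i,j) * (x $ i * y $ j))"
    using A x y by (auto simp: scalar_prod_def sum_distrib_left mult_ac lessThan_atLeast0 intro!: sum.cong)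
  also have "\<dots> = (\<Sum>j<n. \<Sum>i<n. A $$ (i,j) * (x $ i * y $ j))"
    by (rule sum.swap)
  also have "\<dots> = y \<bullet> (A *\<^sub>v x)"
    using A x y sym by (auto simp: scalar_prod_def sum_distrib_left mult_ac lessThan_atLeast0 intro!: sum.cong)
  finally show ?thesis .
qed

definition avg_mat :: "nat \<Rightarrow> real mat" where
  "avg_mat n = (1 / real n) \<cdot>\<^sub>m mat n n (\<lambda>_. 1)"

lemma avg_mat_carrier [simp]: "avg_mat n \<in> carrier_mat n n"
  by (simp add: avg_mat_def)

lemma avg_mat_index [simp]: "i < n \<Longrightarrow> j < n \<Longrightarrow> avg_mat n $$ (i,j) = 1 / real n"
  and avg_mat_dim [simp]: "dim_row (avg_mat n) = n" "dim_col (avg_mat n) = n"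
  by (simp_all add: avg_mat_def)

lemma avg_mat_idem: "avg_mat n * avg_mat n = avg_mat n"
  by (rule eq_matI) (auto simp: avg_mat_def scalar_prod_def)

lemma avg_mat_mult_vec:
  "x \<in> carrier_vec n \<Longrightarrow> i < n \<Longrightarrow> (avg_mat n *\<^sub>v x) $ i = (\<Sum>j<n. x $ j) / real n"
  by (auto simp: avg_mat_def scalar_prod_def sum_divide_distrib lessThan_atLeast0)

section \<open>The Laplacian of a weighted graph\<close>

locale graph =
  fixes n :: nat and W :: "real mat"
  assumes graph: "weighted_graph n W"
begin

abbreviation "L \<equiv> laplacian n W"

lemma laplacian_carrier [simp]: "L \<in> carrier_mat n n"
  and laplacian_dim [simp]: "dim_row L = n" "dim_col L = n"
  by (simp_all add: laplacian_def)

lemma weight_sym: "i < n \<Longrightarrow> j < n \<Longrightarrow> W $$ (i,j) = W $$ (j,i)"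
  and weight_nonneg: "i < n \<Longrightarrow> j < n \<Longrightarrow> W $$ (i,j) \<ge> 0"
  using graph by (auto simp: weighted_graph_def)

lemma laplacian_sym: "i < n \<Longrightarrow> j < n \<Longrightarrow> L $$ (i,j) = L $$ (j,i)"
  by (auto simp: laplacian_def weight_sym)

lemma laplacian_mult_vec:
  assumes x: "x \<in> carrier_vec n" and i: "i < n"
  shows "(L *\<^sub>v x) $ i = (\<Sum>k<n. W $$ (i,k) * (x $ i - x $ k))"
proof -
  have "(L *\<^sub>v x) $ i = (\<Sum>k<n. L $$ (i,k) * x $ k)"
    using x i laplacian_carrier
    by (auto simp: scalar_prod_def lessThan_atLeast0 laplacian_def intro!: sum.cong)
  also have "\<dots> = L $$ (i,i) * x $ i + (\<Sum>k\<in>{..<n}-{i}. L $$ (i,k) * x $ k)"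
    using i by (subst sum.remove[of _ i]) auto
  also have "L $$ (i,i) * x $ i = (\<Sum>k\<in>{..<n}-{i}. W $$ (i,k) * x $ i)"
    using i by (simp add: laplacian_def sum_distrib_right lessThan_atLeast0)
  also have "(\<Sum>k\<in>{..<n}-{i}. L $$ (i,k) * x $ k) = (\<Sum>k\<in>{..<n}-{i}. - (W $$ (i,k) * x $ k))"
    using i by (intro sum.cong) (auto simp: laplacian_def)
  also have "(\<Sum>k\<in>{..<n}-{i}. W $$ (i,k) * x $ i) + \<dots> = (\<Sum>k\<in>{..<n}-{i}. W $$ (i,k) * (x $ i - x $ k))"
    by (simp add: sum.distrib[symmetric] right_diff_distrib)
  also have "\<dots> = (\<Sum>k<n. W $$ (i,k) * (x $ i - x $ k))"
    using i by (subst (2) sum.remove[of _ i]) auto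
  finally show ?thesis .
qed

text \<open>The double sum for x . L x is added to its copy with i and k exchanged; symmetry of the
  weights then combines the factors x_i and - x_k into a square, which is where the factor 2 comes
  from.\<close>

lemma laplacian_quadratic_form:
  assumes x: "x \<in> carrier_vec n"
  shows "2 * (x \<bullet> (L *\<^sub>v x)) = (\<Sum>i<n. \<Sum>k<n. W $$ (i,k) * (x $ i - x $ k)\<^sup>2)"
proof -
  have 1: "x \<bullet> (L *\<^sub>v x) = (\<Sum>i<n. \<Sum>k<n. W $$ (i,k) * (x $ i - x $ k) * x $ i)"
    using x laplacian_carrier laplacian_mult_vec[OF x]
    by (auto simp: scalar_prod_def sum_distrib_left sum_distrib_right lessThan_atLeast0 mult_ac
        simp del: index_mult_mat_vec intro!: sum.cong)
  also have "\<dots> = (\<Sum>k<n. \<Sum>i<n. W $$ (i,k) * (x $ i - x $ k) * x $ i)"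
    by (rule sum.swap)
  also have "\<dots> = (\<Sum>i<n. \<Sum>k<n. - (W $$ (i,k) * (x $ i - x $ k) * x $ k))"
    by (intro sum.cong refl) (auto simp: weight_sym algebra_simps)
  finally have "2 * (x \<bullet> (L *\<^sub>v x)) = (\<Sum>i<n. \<Sum>k<n. W $$ (i,k) * (x $ i - x $ k) * x $ i)
      + (\<Sum>i<n. \<Sum>k<n. - (W $$ (i,k) * (x $ i - x $ k) * x $ k))"
    using 1 by simp
  also have "\<dots> = (\<Sum>i<n. \<Sum>k<n. W $$ (i,k) * (x $ i - x $ k)\<^sup>2)"
    by (simp add: sum.distrib[symmetric] power2_eq_square algebra_simps)
  finally show ?thesis .
qed

lemma laplacian_psd:
  assumes "x \<in> carrier_vec n"
  shows "x \<bullet> (L *\<^sub>v x) \<ge> 0"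
proof -
  have "0 \<le> (\<Sum>i<n. \<Sum>k<n. W $$ (i,k) * (x $ i - x $ k)\<^sup>2)"
    using weight_nonneg by (intro sum_nonneg) auto
  then show ?thesis using laplacian_quadratic_form[OF assms] by linarith
qed

text \<open>A vanishing sum of nonnegative terms vanishes term by term, so x agrees at the ends of
  every edge, and connectedness carries this along paths.\<close>

lemma laplacian_kernel:
  assumes con: "connected_graph n W" and x: "x \<in> carrier_vec n" and Lx: "L *\<^sub>v x = 0\<^sub>v n"
    and i: "i < n" and j: "j < n"
  shows "x $ i = x $ j"
proof -
  have "(\<Sum>i<n. \<Sum>k<n. W $$ (i,k) * (x $ i - x $ k)\<^sup>2) = 0"
    using laplacian_quadratic_form[OF x] Lx x by simp
  then have row: "(\<Sum>k<n. W $$ (i,k) * (x $ i - x $ k)\<^sup>2) = 0" if "i < n" for i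
    using that weight_nonneg by (subst (asm) sum_nonneg_eq_0_iff) (auto intro!: sum_nonneg)
  have edge: "x $ a = x $ b" if "(a,b) \<in> edges n W" for a b
  proof -
    have ab: "a < n" "b < n" "W $$ (a,b) > 0" using that by (auto simp: edges_def)
    have "\<forall>k\<in>{..<n}. W $$ (a,k) * (x $ a - x $ k)\<^sup>2 = 0"
      using row[OF ab(1)] weight_nonneg[OF ab(1)] by (subst (asm) sum_nonneg_eq_0_iff) auto
    then have "W $$ (a,b) * (x $ a - x $ b)\<^sup>2 = 0" using ab(2) by blast
    then show ?thesis using ab(3) by simp
  qed
  have "(i,j) \<in> (edges n W)\<^sup>*"
    using con i j by (cases "i = j") (auto simp: connected_graph_def)
  then show ?thesis
    by induction (auto dest: edge)
qed

lemma laplacian_row_sum: "i < n \<Longrightarrow> (\<Sum>j<n. L $$ (i,j)) = 0"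
  using laplacian_mult_vec[of "vec n (\<lambda>_. 1)" i] laplacian_carrier
  by (simp add: scalar_prod_def lessThan_atLeast0)

lemma laplacian_avg: "L * avg_mat n = 0\<^sub>m n n"
proof (rule eq_matI)
  fix i j assume ij: "i < dim_row (0\<^sub>m n n)" "j < dim_col (0\<^sub>m n n)"
  then have "(L * avg_mat n) $$ (i,j) = (\<Sum>k<n. L $$ (i,k)) / real n"
    using laplacian_carrier
    by (auto simp: scalar_prod_def lessThan_atLeast0 sum_divide_distrib)
  then show "(L * avg_mat n) $$ (i,j) = 0\<^sub>m n n $$ (i,j)"
    using ij by (simp add: laplacian_row_sum)
qed (use laplacian_carrier avg_mat_carrier in auto)

lemma avg_laplacian: "avg_mat n * L = 0\<^sub>m n n"
proof (rule eq_matI)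
  fix i j assume ij: "i < dim_row (0\<^sub>m n n)" "j < dim_col (0\<^sub>m n n)"
  then have "(avg_mat n * L) $$ (i,j) = (\<Sum>k<n. L $$ (k,j)) / real n"
    using laplacian_carrier
    by (auto simp: scalar_prod_def lessThan_atLeast0 sum_divide_distrib)
  also have "(\<Sum>k<n. L $$ (k,j)) = (\<Sum>k<n. L $$ (j,k))"
    using ij laplacian_sym by (intro sum.cong) auto
  finally show "(avg_mat n * L) $$ (i,j) = 0\<^sub>m n n $$ (i,j)"
    using ij by (simp add: laplacian_row_sum)
qed (use laplacian_carrier avg_mat_carrier in auto)

text \<open>Averaging annihilates the range of L, so applying it to L v = k v leaves k times the
  average of v equal to zero.\<close>

lemma laplacian_eigenvector_avg:
  assumes "eigenvector L v k" "k \<noteq> 0"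
  shows "avg_mat n *\<^sub>v v = 0\<^sub>v n"
proof -
  have v: "v \<in> carrier_vec n" "L *\<^sub>v v = k \<cdot>\<^sub>v v"
    using assms laplacian_carrier by (auto simp: eigenvector_def)
  have "k \<cdot>\<^sub>v (avg_mat n *\<^sub>v v) = avg_mat n *\<^sub>v (L *\<^sub>v v)"
    using v by (simp add: mult_mat_vec[of _ n n])
  also have "\<dots> = 0\<^sub>v n"
    using assoc_mult_mat_vec[of "avg_mat n" n n L n v] v by (simp add: avg_laplacian del: assoc_mult_mat_vec)
  finally have z: "k \<cdot>\<^sub>v (avg_mat n *\<^sub>v v) = 0\<^sub>v n" .
  show ?thesis
  proof (rule eq_vecI)
    fix i assume "i < dim_vec (0\<^sub>v n)"
    then show "(avg_mat n *\<^sub>v v) $ i = 0\<^sub>v n $ i"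
      using arg_cong[OF z, of "\<lambda>u. u $ i"] assms(2) avg_mat_carrier[of n]
      by (auto simp del: index_mult_mat_vec)
  qed (use avg_mat_carrier[of n] in auto)
qed

text \<open>The matrix A = L + \<mu> J - \<mu> I is zero on constants and L - \<mu> on their
  orthogonal complement, so the claim is semidefiniteness of A. An eigenvector v of A for some k < 0
  has J v = 0, hence L v = (k + \<mu>) v. Since k + \<mu> < \<mu>, the assumption on \<mu> leaves
  only k + \<mu> = 0, and then v is constant with zero average.\<close>

lemma laplacian_spectral_gap:
  assumes con: "connected_graph n W" and mu: "\<And>k. eigenvalue L k \<Longrightarrow> k \<noteq> 0 \<Longrightarrow> \<mu> \<le> k"
    and x: "x \<in> carrier_vec n" and avg: "avg_mat n *\<^sub>v x = 0\<^sub>v n"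
  shows "\<mu> * (x \<bullet> x) \<le> x \<bullet> (L *\<^sub>v x)"
proof -
  let ?J = "avg_mat n"
  define A where "A = L + \<mu> \<cdot>\<^sub>m ?J - \<mu> \<cdot>\<^sub>m 1\<^sub>m n"
  have A: "A \<in> carrier_mat n n" by (simp add: A_def minus_carrier_mat)
  have Av: "A *\<^sub>v y = L *\<^sub>v y + \<mu> \<cdot>\<^sub>v (?J *\<^sub>v y) - \<mu> \<cdot>\<^sub>v y" if "y \<in> carrier_vec n" for y
    using that by (simp add: A_def minus_mult_distrib_mat_vec[of _ n n] add_mult_distrib_mat_vec[of _ n n]
        smult_mult_mat_vec[of _ n n])
  have "x \<bullet> (A *\<^sub>v x) \<ge> 0"
  proof (rule psd_if_eigenvalues_nonneg[OF A _ _ x])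
    have sym: "A $$ (i,j) = A $$ (j,i)" if "i < n" "j < n" for i j
      using that laplacian_sym[OF that] laplacian_carrier avg_mat_carrier[of n]
      by (auto simp: A_def avg_mat_def)
    show "y \<bullet> (A *\<^sub>v z) = z \<bullet> (A *\<^sub>v y)" if "y \<in> carrier_vec n" "z \<in> carrier_vec n" for y z
      by (rule symmetric_quadratic_form[OF A sym that])
  next
    fix k assume "eigenvalue A k"
    then obtain v where v: "v \<in> carrier_vec n" "v \<noteq> 0\<^sub>v n" "A *\<^sub>v v = k \<cdot>\<^sub>v v"
      using A by (auto simp: eigenvalue_def eigenvector_def)
    show "k \<ge> 0"
    proof (rule ccontr)
      assume k: "\<not> k \<ge> 0"
      have JL: "?J *\<^sub>v (L *\<^sub>v v) = 0\<^sub>v n"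
        using assoc_mult_mat_vec[of "avg_mat n" n n L n v] v by (simp add: avg_laplacian del: assoc_mult_mat_vec)
      have JJ: "?J *\<^sub>v (?J *\<^sub>v v) = ?J *\<^sub>v v"
        using assoc_mult_mat_vec[of ?J n n ?J n v] v by (simp add: avg_mat_idem del: assoc_mult_mat_vec)
      have "k \<cdot>\<^sub>v (?J *\<^sub>v v) = ?J *\<^sub>v (A *\<^sub>v v)"
        unfolding v(3) by (rule mult_mat_vec[OF avg_mat_carrier v(1), symmetric])
      also have "\<dots> = 0\<^sub>v n + \<mu> \<cdot>\<^sub>v (?J *\<^sub>v v) - \<mu> \<cdot>\<^sub>v (?J *\<^sub>v v)"
      proof -
        have c: "L *\<^sub>v v \<in> carrier_vec n" "?J *\<^sub>v v \<in> carrier_vec n"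
          by (rule mult_mat_vec_carrier[OF _ v(1)], simp)+
        have "?J *\<^sub>v (A *\<^sub>v v) = ?J *\<^sub>v (L *\<^sub>v v + \<mu> \<cdot>\<^sub>v (?J *\<^sub>v v)) - ?J *\<^sub>v (\<mu> \<cdot>\<^sub>v v)"
          unfolding Av[OF v(1)] using c v(1) by (intro mult_minus_distrib_mat_vec[of _ n n]) auto
        also have "?J *\<^sub>v (L *\<^sub>v v + \<mu> \<cdot>\<^sub>v (?J *\<^sub>v v)) = ?J *\<^sub>v (L *\<^sub>v v) + ?J *\<^sub>v (\<mu> \<cdot>\<^sub>v (?J *\<^sub>v v))"
          using c by (intro mult_add_distrib_mat_vec[of _ n n]) auto
        also have "?J *\<^sub>v (\<mu> \<cdot>\<^sub>v (?J *\<^sub>v v)) = \<mu> \<cdot>\<^sub>v (?J *\<^sub>v v)"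
          using mult_mat_vec[OF avg_mat_carrier c(2)] by (simp only: JJ)
        also have "?J *\<^sub>v (\<mu> \<cdot>\<^sub>v v) = \<mu> \<cdot>\<^sub>v (?J *\<^sub>v v)"
          by (rule mult_mat_vec[OF avg_mat_carrier v(1)])
        finally show ?thesis by (simp only: JL)
      qed
      finally have z: "k \<cdot>\<^sub>v (?J *\<^sub>v v) = 0\<^sub>v n + \<mu> \<cdot>\<^sub>v (?J *\<^sub>v v) - \<mu> \<cdot>\<^sub>v (?J *\<^sub>v v)" .
      have Jv: "?J *\<^sub>v v = 0\<^sub>v n"
      proof (rule eq_vecI)
        fix i assume "i < dim_vec (0\<^sub>v n)"
        then show "(?J *\<^sub>v v) $ i = 0\<^sub>v n $ i"
          using arg_cong[OF z, of "\<lambda>u. u $ i"] k by (simp del: index_mult_mat_vec)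
      qed (use avg_mat_carrier[of n] in auto)
      have Lv: "L *\<^sub>v v = (k + \<mu>) \<cdot>\<^sub>v v"
      proof (rule eq_vecI)
        fix i assume "i < dim_vec ((k + \<mu>) \<cdot>\<^sub>v v)"
        then show "(L *\<^sub>v v) $ i = ((k + \<mu>) \<cdot>\<^sub>v v) $ i"
          using arg_cong[OF v(3)[unfolded Av[OF v(1)] Jv], of "\<lambda>u. u $ i"] v(1)
          by (simp add: algebra_simps del: index_mult_mat_vec)
      qed (use v laplacian_carrier in auto)
      then have "eigenvalue L (k + \<mu>)"
        using v laplacian_carrier by (auto simp: eigenvalue_def eigenvector_def intro!: exI[of _ v])
      then have "k + \<mu> = 0" using mu k by force
      then have L0: "L *\<^sub>v v = 0\<^sub>v n" using Lv v by auto
      have "v = 0\<^sub>v n"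
      proof (rule eq_vecI)
        fix i assume i: "i < dim_vec (0\<^sub>v n)"
        have "(\<Sum>j<n. v $ j) = (\<Sum>j<n. v $ i)"
          by (intro sum.cong refl laplacian_kernel[OF con v(1) L0]) (use i in auto)
        moreover have "(\<Sum>j<n. v $ j) / real n = 0"
          using arg_cong[OF Jv, of "\<lambda>u. u $ i"] i avg_mat_mult_vec[OF v(1)] by simp
        ultimately show "v $ i = 0\<^sub>v n $ i" using i by simp
      qed (use v in auto)
      then show False using v by simp
    qed
  qed
  moreover have "A *\<^sub>v x = L *\<^sub>v x - \<mu> \<cdot>\<^sub>v x"
    unfolding Av[OF x] avg using x by (intro eq_vecI) (auto simp del: index_mult_mat_vec)
  moreover have "L *\<^sub>v x \<in> carrier_vec n"
    by (rule mult_mat_vec_carrier[OF laplacian_carrier x])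
  ultimately show ?thesis
    using x by (simp add: scalar_prod_minus_distrib[of _ n])
qed

text \<open>\<open>Min\<close> carries information only for a finite nonempty set, so the nonzero
  eigenvalues are first shown to form one. The gap estimate is then the case \<mu> = lam2 of the
  preceding lemma, and positivity follows from semidefiniteness of L.\<close>

lemma algebraic_connectivity:
  assumes n: "n \<ge> 2" and con: "connected_graph n W"
  defines "lam2 \<equiv> min_nonzero_eigenvalue L"
  shows algebraic_connectivity_eigenvalue: "eigenvalue L lam2"
    and algebraic_connectivity_pos: "lam2 > 0"
    and algebraic_connectivity_gap:
      "\<And>x. x \<in> carrier_vec n \<Longrightarrow> avg_mat n *\<^sub>v x = 0\<^sub>v n \<Longrightarrow> lam2 * (x \<bullet> x) \<le> x \<bullet> (L *\<^sub>v x)"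
proof -
  let ?E = "{k. eigenvalue L k \<and> k \<noteq> 0}"
  have fin: "finite ?E"
    using card_finite_spectrum(1)[OF laplacian_carrier] by (auto simp: spectrum_def)
  \<comment> \<open>Without nonzero eigenvalues the gap estimate would hold vacuously for every
    \<mu>, which is absurd for large \<mu>. The test vector e_0 - e_1 is orthogonal to the constants
    and requires two vertices.\<close>
  have ne: "?E \<noteq> {}"
  proof
    assume E: "?E = {}"
    define x :: "real vec" where "x = vec n (\<lambda>i. if i = 0 then 1 else if i = 1 then - 1 else 0)"
    have x: "x \<in> carrier_vec n" by (simp add: x_def)
    have "(\<Sum>i<n. x $ i) = (\<Sum>i\<in>{0,1}. x $ i)"
      using n by (intro sum.mono_neutral_right) (auto simp: x_def)
    also have "\<dots> = 0" using n by (simp add: x_def)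
    finally have "avg_mat n *\<^sub>v x = 0\<^sub>v n"
      using x avg_mat_carrier[of n]
      by (intro eq_vecI) (auto simp: avg_mat_mult_vec simp del: index_mult_mat_vec)
    then have gap: "\<mu> * (x \<bullet> x) \<le> x \<bullet> (L *\<^sub>v x)" for \<mu>
      using laplacian_spectral_gap[OF con _ x, of \<mu>] E by blast
    have "x \<noteq> 0\<^sub>v n"
      using n by (auto simp: x_def dest!: arg_cong[of _ _ "\<lambda>u. u $ 0"])
    then have "x \<bullet> x > 0"
      using scalar_prod_self_eq_0[OF x] scalar_prod_self_nonneg[of x] by linarith
    then show False
      using gap[of "(x \<bullet> (L *\<^sub>v x)) / (x \<bullet> x) + 1"] by (simp add: field_simps)
  qed
  have lam2: "lam2 \<in> ?E"
    using Min_in[OF fin ne] unfolding lam2_def min_nonzero_eigenvalue_def .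
  then show "eigenvalue L lam2" by simp
  have le: "lam2 \<le> k" if "eigenvalue L k" "k \<noteq> 0" for k
    unfolding lam2_def min_nonzero_eigenvalue_def using Min_le[OF fin] that by blast
  show "lam2 * (x \<bullet> x) \<le> x \<bullet> (L *\<^sub>v x)"
    if "x \<in> carrier_vec n" "avg_mat n *\<^sub>v x = 0\<^sub>v n" for x
    by (rule laplacian_spectral_gap[OF con le that])
  obtain v where v: "v \<in> carrier_vec n" "v \<noteq> 0\<^sub>v n" "L *\<^sub>v v = lam2 \<cdot>\<^sub>v v"
    using lam2 laplacian_carrier by (auto simp: eigenvalue_def eigenvector_def)
  have "v \<bullet> v > 0"
    using scalar_prod_self_eq_0[OF v(1)] v(2) scalar_prod_self_nonneg[of v] by linarith
  then have "lam2 \<ge> 0"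
    using laplacian_psd[OF v(1)] v by (simp add: zero_le_mult_iff)
  then show "lam2 > 0" using lam2 by auto
qed

end

subsection \<open>The transfer matrix\<close>

interpretation const_poly_hom: comm_ring_hom "\<lambda>a. [:complex_of_real a:]"
  by unfold_locales (auto simp: one_pCons)

interpretation to_fract_hom: comm_ring_hom "to_fract :: complex poly \<Rightarrow> complex poly fract"
  by unfold_locales auto

lemma append_rows_index:
  "dim_col B = dim_col A \<Longrightarrow> i < dim_row A + dim_row B \<Longrightarrow> j < dim_col A \<Longrightarrow>
    (A @\<^sub>r B) $$ (i,j) = (if i < dim_row A then A $$ (i,j) else B $$ (i - dim_row A, j))"
  "dim_row (A @\<^sub>r B) = dim_row A + dim_row B" "dim_col (A @\<^sub>r B) = dim_col A"
  by (auto simp: append_rows_def)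

lemma append_rows_mult:
  fixes E F G :: "'a :: comm_ring_1 mat"
  assumes "E \<in> carrier_mat m n" "F \<in> carrier_mat k n" "G \<in> carrier_mat n l"
  shows "(E @\<^sub>r F) * G = (E * G) @\<^sub>r (F * G)"
  using assms by (intro eq_matI) (auto simp: append_rows_index scalar_prod_def intro!: sum.cong)

lemma four_block_mult_append_rows:
  fixes A B C D E F :: "'a :: comm_ring_1 mat"
  assumes "A \<in> carrier_mat m n" "B \<in> carrier_mat m k" "C \<in> carrier_mat l n" "D \<in> carrier_mat l k"
    and "E \<in> carrier_mat n p" "F \<in> carrier_mat k p"
  shows "four_block_mat A B C D * (E @\<^sub>r F) = (A * E + B * F) @\<^sub>r (C * E + D * F)"
proof -
  have "four_block_mat A B C D * (E @\<^sub>r F) =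
    four_block_mat (A * E + B * F) (A * 0\<^sub>m n 0 + B * 0\<^sub>m k 0) (C * E + D * F) (C * 0\<^sub>m n 0 + D * 0\<^sub>m k 0)"
    unfolding append_rows_def using assms mult_four_block_mat[of A m n B k C l D E p "0\<^sub>m n 0" 0 F "0\<^sub>m k 0"]
    by auto
  then show ?thesis
    unfolding append_rows_def using assms by auto
qed

lemma map_append_rows:
  assumes "A \<in> carrier_mat m n" "B \<in> carrier_mat k n"
  shows "map_mat f (A @\<^sub>r B) = map_mat f A @\<^sub>r map_mat f B"
  using assms by (intro eq_matI) (auto simp: append_rows_index)

text \<open>A rational solution \<open>X\<close> of \<open>X Q = P\<close> has its poles among the zeros of \<open>det Q\<close>, so the equation
  can be evaluated wherever \<open>det Q\<close> does not vanish, even if \<open>X\<close> was defined through matrices with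
  further poles.\<close>

lemma eval_tf_linear_system:
  assumes X: "X \<in> carrier_mat m n" and Q: "Q \<in> carrier_mat n n" and P: "P \<in> carrier_mat m n"
    and eq: "X * map_mat to_fract Q = map_mat to_fract P"
    and det: "det (map_mat (\<lambda>p. poly p z) Q) \<noteq> 0"
  shows "eval_tf X z * map_mat (\<lambda>p. poly p z) Q = map_mat (\<lambda>p. poly p z) P"
proof -
  let ?f = "map_mat (to_fract :: complex poly \<Rightarrow> _)" and ?e = "map_mat (\<lambda>p. poly p z)"
  define \<delta> where "\<delta> = det Q"
  have \<delta>: "poly \<delta> z \<noteq> 0" using det comm_ring_hom.hom_det[OF poly_hom.comm_ring_hom_axioms, of z Q] by (simp add: \<delta>_def)
  then have \<delta>0: "\<delta> \<noteq> 0" by auto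
  note adj = adj_mat[OF Q, folded \<delta>_def]
  \<comment> \<open>Multiplying X Q = P by the adjugate yields \<delta> X = R. The entries of X are
    thus fractions over \<delta>, which is nonzero at z, and \<open>eval_ratfun_Fract\<close>
    evaluates such a fraction whether or not it is reduced.\<close>
  define R where "R = P * adj_mat Q"
  have R: "R \<in> carrier_mat m n" using P adj by (simp add: R_def)
  have "?f R = ?f P * ?f (adj_mat Q)"
    unfolding R_def using P adj(1) by (rule to_fract_hom.mat_hom_mult)
  also have "\<dots> = X * (?f Q * ?f (adj_mat Q))"
    unfolding eq[symmetric] using X Q adj(1) by (intro assoc_mult_mat[of _ m n _ n _ n]) auto
  also have "?f Q * ?f (adj_mat Q) = ?f (\<delta> \<cdot>\<^sub>m 1\<^sub>m n)"
    using to_fract_hom.mat_hom_mult[OF Q adj(1)] adj(2) by simp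
  also have "\<dots> = to_fract \<delta> \<cdot>\<^sub>m 1\<^sub>m n"
    by (intro eq_matI) auto
  also have "X * \<dots> = to_fract \<delta> \<cdot>\<^sub>m X"
    by (simp add: mult_smult_distrib[OF X one_carrier_mat] right_mult_one_mat[OF X])
  finally have fR: "?f R = to_fract \<delta> \<cdot>\<^sub>m X" .
  have X_index: "X $$ (i,j) = Fract (R $$ (i,j)) \<delta>" if "i < m" "j < n" for i j
    using arg_cong[OF fR, of "\<lambda>A. A $$ (i,j)"] that R X \<delta>0
    by (simp add: Fract_conv_to_fract field_simps)
  have eX: "eval_tf X z = (1 / poly \<delta> z) \<cdot>\<^sub>m ?e R"
    using X R \<delta> by (intro eq_matI) (auto simp: eval_tf_def X_index eval_ratfun_Fract)
  have "R * Q = P * (adj_mat Q * Q)"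
    unfolding R_def using P Q adj(1) by (intro assoc_mult_mat[of _ m n _ n _ n])
  also have "\<dots> = \<delta> \<cdot>\<^sub>m P"
    by (simp add: adj(3) mult_smult_distrib[OF P one_carrier_mat] right_mult_one_mat[OF P])
  finally have RQ: "R * Q = \<delta> \<cdot>\<^sub>m P" .
  have "eval_tf X z * ?e Q = (1 / poly \<delta> z) \<cdot>\<^sub>m (?e R * ?e Q)"
    unfolding eX using R Q by (intro mult_smult_assoc_mat[of _ m n]) auto
  also have "?e R * ?e Q = ?e (\<delta> \<cdot>\<^sub>m P)"
    using semiring_hom.mat_hom_mult[OF poly_hom.semiring_hom_axioms R Q, of z] RQ by simp
  also have "(1 / poly \<delta> z) \<cdot>\<^sub>m \<dots> = ?e P"
    using \<delta> by (intro eq_matI) auto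
  finally show ?thesis .
qed

context graph
begin

text \<open>The value of D + J at the complex number z.\<close>

definition sys_mat :: "real \<Rightarrow> real \<Rightarrow> complex \<Rightarrow> complex mat" where
  "sys_mat \<alpha> \<beta> z = map_mat complex_of_real (\<alpha> \<cdot>\<^sub>m L + avg_mat n) + (z\<^sup>2 + complex_of_real \<beta> * z) \<cdot>\<^sub>m 1\<^sub>m n"

definition out_mat :: "complex \<Rightarrow> complex mat" where
  "out_mat z = map_mat complex_of_real (consensus_proj n) @\<^sub>r (z \<cdot>\<^sub>m map_mat complex_of_real (consensus_proj n))"

lemma consensus_proj_eq: "consensus_proj n = 1\<^sub>m n - avg_mat n"
  by (simp add: consensus_proj_def avg_mat_def)

lemma consensus_proj_carrier [simp]: "consensus_proj n \<in> carrier_mat n n"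
  and consensus_proj_dim [simp]: "dim_row (consensus_proj n) = n" "dim_col (consensus_proj n) = n"
  by (simp_all add: consensus_proj_eq minus_carrier_mat)

lemma consensus_proj_avg: "consensus_proj n * avg_mat n = 0\<^sub>m n n"
  unfolding consensus_proj_eq
  using minus_mult_distrib_mat[of "1\<^sub>m n" n n "avg_mat n" "avg_mat n" n]
  by (auto simp: avg_mat_idem minus_carrier_mat intro!: eq_matI simp del: index_mult_mat(1))

text \<open>Here \<open>D\<close> is the characteristic polynomial matrix of the second-order dynamics. It is singular at
  \<open>0\<close> on the consensus direction; as the transfer matrix annihilates that direction, \<open>D\<close> may be
  replaced by \<open>D\<close> plus the averaging matrix.\<close>

lemma T1_times_sys_mat:
  defines "c \<equiv> map_mat (\<lambda>a. [:complex_of_real a:])" and "s \<equiv> [:0, 1:] :: complex poly"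
  shows "T1 n W \<alpha> \<beta> \<in> carrier_mat (n + n) n"
    and "T1 n W \<alpha> \<beta> * map_mat to_fract (c (\<alpha> \<cdot>\<^sub>m L + avg_mat n) + (s\<^sup>2 + [:complex_of_real \<beta>:] * s) \<cdot>\<^sub>m 1\<^sub>m n)
      = map_mat to_fract (c (consensus_proj n) @\<^sub>r (s \<cdot>\<^sub>m c (consensus_proj n)))"
proof -
  let ?T = "T1 n W \<alpha> \<beta>" and ?f = "map_mat (to_fract :: complex poly \<Rightarrow> _)" and ?J = "avg_mat n"
  let ?A = "abs_vel_state_mat n \<alpha> \<beta> L" and ?\<Phi> = "consensus_proj n"
  define \<sigma> where "\<sigma> = s\<^sup>2 + [:complex_of_real \<beta>:] * s"
  define D where "D = c (\<alpha> \<cdot>\<^sub>m L) + \<sigma> \<cdot>\<^sub>m 1\<^sub>m n"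
  define N where "N = char_poly_matrix (map_mat complex_of_real ?A)"
  \<comment> \<open>The column [1; s 1] encodes that velocity is s times position. It is chosen so
    that (s I - A) [1; s 1] = B D, which gives the resolvent times B D without inverting a block
    matrix.\<close>
  define I where "I = 1\<^sub>m n @\<^sub>r (s \<cdot>\<^sub>m 1\<^sub>m n)"
  define S where "S = c ?\<Phi> @\<^sub>r (s \<cdot>\<^sub>m c ?\<Phi>)"
  have c_carrier: "c M \<in> carrier_mat r k \<longleftrightarrow> M \<in> carrier_mat r k" for M r k
    by (simp add: c_def)
  have const: "const_mat M = ?f (c M)" for M
    by (intro eq_matI) (auto simp: const_mat_def c_def)
  have A: "?A \<in> carrier_mat (n + n) (n + n)"
    by (simp add: abs_vel_state_mat_def)
  then have N: "N \<in> carrier_mat (n + n) (n + n)" by (simp add: N_def)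
  have D: "D \<in> carrier_mat n n" by (simp add: D_def c_carrier)
  have I: "I \<in> carrier_mat (n + n) n" by (simp add: I_def)
  have S: "S \<in> carrier_mat (n + n) n" by (auto simp: S_def c_carrier)
  have B: "input_mat n \<in> carrier_mat (n + n) n" by (simp add: input_mat_def)
  have C: "output_mat n \<in> carrier_mat (n + n) (n + n)" by (simp add: output_mat_def)
  obtain R where R: "mat_inverse (?f N) = Some R" "R \<in> carrier_mat (n + n) (n + n)"
      "R * ?f N = 1\<^sub>m (n + n)"
    using mat_inverse_resolvent[of "map_mat complex_of_real ?A" "n + n"] A by (auto simp: N_def)
  have T: "?T = ?f (c (output_mat n)) * R * ?f (c (input_mat n))"
    using R(1) by (simp add: T1_def transfer_matrix_def const N_def)
  show T_carrier: "?T \<in> carrier_mat (n + n) n"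
    unfolding T using B C R(2) by (auto simp: c_carrier intro!: mult_carrier_mat)

  have N_blocks: "N = four_block_mat (s \<cdot>\<^sub>m 1\<^sub>m n) (- 1\<^sub>m n) (c (\<alpha> \<cdot>\<^sub>m L)) ((s + [:complex_of_real \<beta>:]) \<cdot>\<^sub>m 1\<^sub>m n)"
    unfolding N_def char_poly_matrix_def
    by (rule eq_matI) (auto simp: abs_vel_state_mat_def c_def s_def one_pCons)
  have "N * I = (s \<cdot>\<^sub>m 1\<^sub>m n * 1\<^sub>m n + (- 1\<^sub>m n) * (s \<cdot>\<^sub>m 1\<^sub>m n))
      @\<^sub>r (c (\<alpha> \<cdot>\<^sub>m L) * 1\<^sub>m n + (s + [:complex_of_real \<beta>:]) \<cdot>\<^sub>m 1\<^sub>m n * (s \<cdot>\<^sub>m 1\<^sub>m n))"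
    unfolding N_blocks I_def by (rule four_block_mult_append_rows[of _ n n _ n _ n]) (auto simp: c_carrier)
  also have "s \<cdot>\<^sub>m 1\<^sub>m n * 1\<^sub>m n + (- 1\<^sub>m n) * (s \<cdot>\<^sub>m 1\<^sub>m n) = 0\<^sub>m n n"
    by (rule eq_matI) auto
  also have "c (\<alpha> \<cdot>\<^sub>m L) * 1\<^sub>m n + (s + [:complex_of_real \<beta>:]) \<cdot>\<^sub>m 1\<^sub>m n * (s \<cdot>\<^sub>m 1\<^sub>m n) = D"
    unfolding D_def \<sigma>_def c_def using laplacian_carrier
    by (intro eq_matI) (auto simp: power2_eq_square algebra_simps)
  also have "0\<^sub>m n n @\<^sub>r D = c (input_mat n) * D"
  proof -
    have "c (input_mat n) = 0\<^sub>m n n @\<^sub>r 1\<^sub>m n"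
      unfolding c_def input_mat_def
      by (subst map_append_rows[of _ n n _ n]) (auto intro!: arg_cong2[of _ _ _ _ append_rows] eq_matI simp: one_pCons)
    then show ?thesis using D by (simp add: append_rows_mult[of _ n n _ n _ n])
  qed
  finally have NI: "N * I = c (input_mat n) * D" .
  have CI: "c (output_mat n) * I = S"
  proof -
    have "c (output_mat n) = four_block_mat (c ?\<Phi>) (0\<^sub>m n n) (0\<^sub>m n n) (c ?\<Phi>)"
      unfolding c_def output_mat_def by (subst map_four_block_mat[of _ n n _ n _ n]) (auto intro!: cong_four_block_mat eq_matI)
    then have "c (output_mat n) * I = (c ?\<Phi> * 1\<^sub>m n + 0\<^sub>m n n * (s \<cdot>\<^sub>m 1\<^sub>m n)) @\<^sub>r (0\<^sub>m n n * 1\<^sub>m n + c ?\<Phi> * (s \<cdot>\<^sub>m 1\<^sub>m n))"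
      unfolding I_def by (simp only:) (rule four_block_mult_append_rows[of _ n n _ n _ n], auto simp: c_carrier)
    also have "c ?\<Phi> * (s \<cdot>\<^sub>m 1\<^sub>m n) = s \<cdot>\<^sub>m c ?\<Phi>"
      using mult_smult_distrib[of "c ?\<Phi>" n n "1\<^sub>m n" n s] right_mult_one_mat[of "c ?\<Phi>" n n]
      by (simp add: c_carrier)
    finally show ?thesis
      using right_mult_one_mat[of "c ?\<Phi>" n n] right_add_zero_mat[of "c ?\<Phi>" n n]
      by (simp add: S_def c_carrier)
  qed

  have TD: "?T * ?f D = ?f S"
  proof -
    have cB: "?f (c (input_mat n)) \<in> carrier_mat (n + n) n" and cC: "?f (c (output_mat n)) \<in> carrier_mat (n + n) (n + n)"
      and fI: "?f I \<in> carrier_mat (n + n) n" and fN: "?f N \<in> carrier_mat (n + n) (n + n)" and fD: "?f D \<in> carrier_mat n n"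
      using B C I N D by (auto simp: c_carrier)
    have "?T * ?f D = ?f (c (output_mat n)) * R * (?f (c (input_mat n)) * ?f D)"
      unfolding T by (rule assoc_mult_mat[OF mult_carrier_mat[OF cC R(2)] cB fD])
    also have "?f (c (input_mat n)) * ?f D = ?f N * ?f I"
      using to_fract_hom.mat_hom_mult[OF N I] to_fract_hom.mat_hom_mult[of "c (input_mat n)" "n + n" n D n] NI B D
      by (simp add: c_carrier)
    also have "?f (c (output_mat n)) * R * (?f N * ?f I) = ?f (c (output_mat n)) * (R * (?f N * ?f I))"
      by (rule assoc_mult_mat[OF cC R(2) mult_carrier_mat[OF fN fI]])
    also have "R * (?f N * ?f I) = ?f I"
      using assoc_mult_mat[OF R(2) fN fI] R(3) fI by simp
    also have "?f (c (output_mat n)) * ?f I = ?f S"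
      using to_fract_hom.mat_hom_mult[of "c (output_mat n)" "n + n" "n + n" I n] C I CI by (simp add: c_carrier)
    finally show ?thesis .
  qed

  have cJ: "c ?J \<in> carrier_mat n n" by (simp add: c_carrier)
  have DJ: "D * c ?J = \<sigma> \<cdot>\<^sub>m c ?J"
  proof -
    have "D * c ?J = c (\<alpha> \<cdot>\<^sub>m L) * c ?J + \<sigma> \<cdot>\<^sub>m 1\<^sub>m n * c ?J"
      unfolding D_def by (rule add_mult_distrib_mat[of _ n n]) (auto simp: c_carrier)
    also have "c (\<alpha> \<cdot>\<^sub>m L) * c ?J = c (\<alpha> \<cdot>\<^sub>m L * ?J)"
      unfolding c_def by (rule const_poly_hom.mat_hom_mult[symmetric, of _ n n _ n]) auto
    also have "\<alpha> \<cdot>\<^sub>m L * ?J = 0\<^sub>m n n"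
      by (subst mult_smult_assoc_mat[of _ n n _ n]) (auto simp: laplacian_avg)
    also have "c (0\<^sub>m n n) = 0\<^sub>m n n"
      by (intro eq_matI) (auto simp: c_def)
    also have "\<sigma> \<cdot>\<^sub>m 1\<^sub>m n * c ?J = \<sigma> \<cdot>\<^sub>m c ?J"
      using mult_smult_assoc_mat[of "1\<^sub>m n" n n "c ?J" n \<sigma>] cJ by simp
    finally show ?thesis using cJ by simp
  qed
  have SJ: "S * c ?J = 0\<^sub>m (n + n) n"
  proof -
    have PJ: "c ?\<Phi> * c ?J = 0\<^sub>m n n"
      unfolding c_def by (subst const_poly_hom.mat_hom_mult[symmetric, of _ n n _ n])
        (auto simp: consensus_proj_avg intro!: eq_matI)
    have "S * c ?J = (c ?\<Phi> * c ?J) @\<^sub>r ((s \<cdot>\<^sub>m c ?\<Phi>) * c ?J)"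
      unfolding S_def using cJ by (intro append_rows_mult[of _ n n _ n _ n]) (auto simp: c_carrier)
    also have "(s \<cdot>\<^sub>m c ?\<Phi>) * c ?J = s \<cdot>\<^sub>m (c ?\<Phi> * c ?J)"
      using cJ by (intro mult_smult_assoc_mat[of _ n n]) (auto simp: c_carrier)
    also have "(c ?\<Phi> * c ?J) @\<^sub>r \<dots> = 0\<^sub>m (n + n) n"
      unfolding PJ by (intro eq_matI) (auto simp: append_rows_index)
    finally show ?thesis .
  qed
  have fJ: "?f (c ?J) \<in> carrier_mat n n" using cJ by simp
  \<comment> \<open>Since D J = \<sigma> J and S J = 0, the product T J is killed by \<sigma>. As a
    rational function \<sigma> is nonzero and can be cancelled; at the point 0, where \<sigma>
    vanishes, this would be impossible.\<close>
  have TJ: "?T * ?f (c ?J) = 0\<^sub>m (n + n) n"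
  proof -
    have "coeff \<sigma> 2 = 1"
      by (simp add: \<sigma>_def s_def power2_eq_square numeral_2_eq_2)
    then have \<sigma>0: "to_fract \<sigma> \<noteq> 0" by auto
    have "to_fract \<sigma> \<cdot>\<^sub>m (?T * ?f (c ?J)) = ?T * (to_fract \<sigma> \<cdot>\<^sub>m ?f (c ?J))"
      using T_carrier fJ by (intro mult_smult_distrib[symmetric])
    also have "to_fract \<sigma> \<cdot>\<^sub>m ?f (c ?J) = ?f (D * c ?J)"
      unfolding DJ by (intro eq_matI) auto
    also have "\<dots> = ?f D * ?f (c ?J)"
      by (rule to_fract_hom.mat_hom_mult[OF D cJ])
    also have "?T * \<dots> = ?f S * ?f (c ?J)"
      unfolding TD[symmetric] using T_carrier D fJ by (intro assoc_mult_mat[symmetric, of _ "n + n" n _ n]) auto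
    also have "\<dots> = ?f (S * c ?J)"
      by (rule to_fract_hom.mat_hom_mult[OF S cJ, symmetric])
    also have "\<dots> = 0\<^sub>m (n + n) n"
      unfolding SJ by (intro eq_matI) auto
    finally have z: "to_fract \<sigma> \<cdot>\<^sub>m (?T * ?f (c ?J)) = 0\<^sub>m (n + n) n" .
    show ?thesis
    proof (rule eq_matI)
      fix i j assume "i < dim_row (0\<^sub>m (n + n) n)" "j < dim_col (0\<^sub>m (n + n) n)"
      then show "(?T * ?f (c ?J)) $$ (i,j) = 0\<^sub>m (n + n) n $$ (i,j)"
        using arg_cong[OF z, of "\<lambda>M. M $$ (i,j)"] \<sigma>0 T_carrier fJ by (simp del: index_mult_mat(1))
    qed (use T_carrier fJ in auto)
  qed
  have "c (\<alpha> \<cdot>\<^sub>m L + ?J) + \<sigma> \<cdot>\<^sub>m 1\<^sub>m n = D + c ?J"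
    unfolding D_def c_def using laplacian_carrier by (intro eq_matI) auto
  then have "?f (c (\<alpha> \<cdot>\<^sub>m L + ?J) + \<sigma> \<cdot>\<^sub>m 1\<^sub>m n) = ?f D + ?f (c ?J)"
    using D cJ by (auto intro!: eq_matI)
  then have "?T * ?f (c (\<alpha> \<cdot>\<^sub>m L + ?J) + \<sigma> \<cdot>\<^sub>m 1\<^sub>m n) = ?T * ?f D + ?T * ?f (c ?J)"
    using T_carrier D fJ by (simp add: mult_add_distrib_mat[of _ "n + n" n _ n])
  also have "\<dots> = ?f S" using S by (simp add: TD TJ)
  finally show "?T * ?f (c (\<alpha> \<cdot>\<^sub>m L + ?J) + (s\<^sup>2 + [:complex_of_real \<beta>:] * s) \<cdot>\<^sub>m 1\<^sub>m n) = ?f (c ?\<Phi> @\<^sub>r (s \<cdot>\<^sub>m c ?\<Phi>))"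
    unfolding \<sigma>_def S_def .
qed

lemma eval_T1:
  assumes det: "det (sys_mat \<alpha> \<beta> z) \<noteq> 0"
  shows "eval_tf (T1 n W \<alpha> \<beta>) z * sys_mat \<alpha> \<beta> z = out_mat z"
proof -
  let ?c = "map_mat (\<lambda>a. [:complex_of_real a:])" and ?s = "[:0, 1:] :: complex poly"
  let ?Q = "?c (\<alpha> \<cdot>\<^sub>m L + avg_mat n) + (?s\<^sup>2 + [:complex_of_real \<beta>:] * ?s) \<cdot>\<^sub>m 1\<^sub>m n"
  let ?P = "?c (consensus_proj n) @\<^sub>r (?s \<cdot>\<^sub>m ?c (consensus_proj n))"
  have Q: "map_mat (\<lambda>p. poly p z) ?Q = sys_mat \<alpha> \<beta> z"
    by (intro eq_matI) (auto simp: sys_mat_def)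
  have P: "map_mat (\<lambda>p. poly p z) ?P = out_mat z"
    using consensus_proj_carrier by (intro eq_matI) (auto simp: out_mat_def append_rows_index)
  have "eval_tf (T1 n W \<alpha> \<beta>) z * map_mat (\<lambda>p. poly p z) ?Q = map_mat (\<lambda>p. poly p z) ?P"
  proof (rule eval_tf_linear_system[OF T1_times_sys_mat(1) _ _ T1_times_sys_mat(2)])
    show "det (map_mat (\<lambda>p. poly p z) ?Q) \<noteq> 0"
      unfolding Q by (rule det)
  qed auto
  then show ?thesis unfolding P Q .
qed

end

subsection \<open>The largest singular value\<close>

lemma mat_adjoint_carrier: "A \<in> carrier_mat nr nc \<Longrightarrow> mat_adjoint A \<in> carrier_mat nc nr"
  and mat_adjoint_index: "A \<in> carrier_mat nr nc \<Longrightarrow> i < nc \<Longrightarrow> j < nr \<Longrightarrow>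
    mat_adjoint A $$ (i,j) = conjugate (A $$ (j,i))"
  by (auto simp: mat_adjoint_def mat_of_rows_def)

lemma mat_adjoint_cscalar_prod:
  fixes A :: "complex mat"
  assumes A: "A \<in> carrier_mat nr nc" and x: "x \<in> carrier_vec nr" and y: "y \<in> carrier_vec nc"
  shows "(mat_adjoint A *\<^sub>v x) \<bullet>c y = x \<bullet>c (A *\<^sub>v y)"
proof -
  note AA = mat_adjoint_carrier[OF A]
  have "(mat_adjoint A *\<^sub>v x) \<bullet>c y = (\<Sum>i<nc. \<Sum>k<nr. cnj (A $$ (k,i)) * x $ k * cnj (y $ i))"
    using A AA x y by (auto simp: scalar_prod_def lessThan_atLeast0 sum_distrib_right mat_adjoint_index[OF A] intro!: sum.cong)
  also have "\<dots> = (\<Sum>k<nr. \<Sum>i<nc. cnj (A $$ (k,i)) * x $ k * cnj (y $ i))"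
    by (rule sum.swap)
  also have "\<dots> = x \<bullet>c (A *\<^sub>v y)"
    using A x y by (auto simp: scalar_prod_def lessThan_atLeast0 sum_distrib_left mult_ac intro!: sum.cong)
  finally show ?thesis .
qed

definition cnorm_sq :: "complex vec \<Rightarrow> real" where
  "cnorm_sq v = Re (v \<bullet>c v)"

text \<open>Real matrices act separately on real and imaginary parts, so this splitting carries
  inequalities for real quadratic forms over to complex vectors.\<close>

lemma cnorm_sq_altdef: "cnorm_sq v = map_vec Re v \<bullet> map_vec Re v + map_vec Im v \<bullet> map_vec Im v"
  by (simp add: cnorm_sq_def scalar_prod_def sum.distrib)

lemma cscalar_prod_self: "v \<bullet>c v = complex_of_real (cnorm_sq v)"
  by (simp add: cnorm_sq_def scalar_prod_def complex_eq_iff algebra_simps)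

lemma cnorm_sq_nonneg: "cnorm_sq v \<ge> 0"
  by (simp add: cnorm_sq_altdef scalar_prod_self_nonneg)

lemma cnorm_sq_eq_0: "v \<in> carrier_vec n \<Longrightarrow> cnorm_sq v = 0 \<Longrightarrow> v = 0\<^sub>v n"
  using conjugate_square_eq_0_vec[of v n] by (simp add: cscalar_prod_self)

lemma cnorm_sq_pos: "v \<in> carrier_vec n \<Longrightarrow> v \<noteq> 0\<^sub>v n \<Longrightarrow> cnorm_sq v > 0"
  using cnorm_sq_eq_0[of v n] cnorm_sq_nonneg[of v] by fastforce

lemma Re_Im_of_real_mat_mult_vec:
  assumes "A \<in> carrier_mat nr nc" "p \<in> carrier_vec nc"
  shows "map_vec Re (map_mat complex_of_real A *\<^sub>v p) = A *\<^sub>v map_vec Re p"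
    and "map_vec Im (map_mat complex_of_real A *\<^sub>v p) = A *\<^sub>v map_vec Im p"
  using assms by (auto simp: scalar_prod_def intro!: eq_vecI)

section \<open>Singular values through the Gram matrix\<close>

context
  fixes M :: "complex mat" and r n :: nat
  assumes M: "M \<in> carrier_mat r n"
begin

lemma gram_mult_vec:
  assumes u: "u \<in> carrier_vec n"
  shows "mat_adjoint M * M *\<^sub>v u = mat_adjoint M *\<^sub>v (M *\<^sub>v u)"
  using assoc_mult_mat_vec[OF mat_adjoint_carrier[OF M] M u] .

text \<open>Pairing the eigenvalue equation with u turns its left side into |M u|^2. As k is an
  arbitrary complex number, this also shows that k is real and nonnegative when u is
  nonzero.\<close>

lemma gram_eigenvector_cnorm_sq:
  assumes u: "u \<in> carrier_vec n" and ev: "mat_adjoint M * M *\<^sub>v u = k \<cdot>\<^sub>v u"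
  shows "complex_of_real (cnorm_sq (M *\<^sub>v u)) = k * complex_of_real (cnorm_sq u)"
proof -
  have Mu: "M *\<^sub>v u \<in> carrier_vec r" using M u by (rule mult_mat_vec_carrier)
  have "complex_of_real (cnorm_sq (M *\<^sub>v u)) = (mat_adjoint M *\<^sub>v (M *\<^sub>v u)) \<bullet>c u"
    using mat_adjoint_cscalar_prod[OF M Mu u] by (simp add: cscalar_prod_self)
  also have "\<dots> = (k \<cdot>\<^sub>v u) \<bullet>c u"
    using gram_mult_vec[OF u] ev by simp
  also have "\<dots> = k * (u \<bullet>c u)" using u by simp
  finally show ?thesis by (simp add: cscalar_prod_self)
qed

lemma gram_carrier: "mat_adjoint M * M \<in> carrier_mat n n"
  using mat_adjoint_carrier[OF M] M by (rule mult_carrier_mat)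

lemma finite_singular_values: "finite (singular_values M)"
proof (rule finite_imageD)
  show "finite ((\<lambda>\<sigma>. complex_of_real (\<sigma>\<^sup>2)) ` singular_values M)"
    using card_finite_spectrum(1)[OF gram_carrier]
    by (rule finite_subset[rotated]) (auto simp: singular_values_def spectrum_def)
  show "inj_on (\<lambda>\<sigma>. complex_of_real (\<sigma>\<^sup>2)) (singular_values M)"
    by (auto simp: inj_on_def singular_values_def simp flip: of_real_power)
qed

text \<open>Over the complex numbers the Gram matrix has an eigenvalue, and the norm identity makes
  it the square of |M u| / |u|. This gives the \<open>Max\<close> in \<open>sigma_max\<close> a
  meaning.\<close>

lemma singular_values_nonempty:
  assumes n: "n > 0"
  shows "singular_values M \<noteq> {}"
proof -
  obtain k u where u: "u \<in> carrier_vec n" "u \<noteq> 0\<^sub>v n" and ev: "mat_adjoint M * M *\<^sub>v u = k \<cdot>\<^sub>v u"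
    using spectrum_non_empty[OF gram_carrier n] gram_carrier
    by (auto simp: spectrum_def eigenvalue_def eigenvector_def)
  define \<sigma> where "\<sigma> = sqrt (cnorm_sq (M *\<^sub>v u) / cnorm_sq u)"
  have "k = complex_of_real (\<sigma>\<^sup>2)"
    using gram_eigenvector_cnorm_sq[OF u(1) ev] cnorm_sq_pos[OF u] cnorm_sq_nonneg[of "M *\<^sub>v u"]
    by (simp add: \<sigma>_def field_simps)
  moreover have "\<sigma> \<ge> 0"
    by (simp add: \<sigma>_def cnorm_sq_nonneg)
  ultimately have "\<sigma> \<in> singular_values M"
    using u ev mat_adjoint_carrier[OF M] by (auto simp: singular_values_def eigenvalue_def eigenvector_def)
  then show ?thesis by auto
qed

lemma sigma_max_le:
  assumes n: "n > 0" and g: "g \<ge> 0"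
    and bound: "\<And>u. u \<in> carrier_vec n \<Longrightarrow> cnorm_sq (M *\<^sub>v u) \<le> g\<^sup>2 * cnorm_sq u"
  shows "sigma_max M \<le> g"
  unfolding sigma_max_def
proof (rule Max.boundedI[OF finite_singular_values singular_values_nonempty[OF n]])
  fix \<sigma> assume \<sigma>: "\<sigma> \<in> singular_values M"
  then obtain u where u: "u \<in> carrier_vec n" "u \<noteq> 0\<^sub>v n"
    and ev: "mat_adjoint M * M *\<^sub>v u = complex_of_real (\<sigma>\<^sup>2) \<cdot>\<^sub>v u"
    using gram_carrier by (auto simp: singular_values_def eigenvalue_def eigenvector_def)
  have "cnorm_sq (M *\<^sub>v u) = \<sigma>\<^sup>2 * cnorm_sq u"
    using gram_eigenvector_cnorm_sq[OF u(1) ev] by (metis of_real_eq_iff of_real_mult)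
  then have "\<sigma>\<^sup>2 \<le> g\<^sup>2" using bound[OF u(1)] cnorm_sq_pos[OF u] by simp
  then show "\<sigma> \<le> g" using g by (rule power2_le_imp_le)
qed

text \<open>An eigenvector of the Gram matrix is demanded, since passing from a mere ratio |M v| /
  |v| to a singular value would need the spectral theorem.\<close>

lemma sigma_max_ge:
  assumes v: "v \<in> carrier_vec n" "v \<noteq> 0\<^sub>v n" and \<sigma>: "\<sigma> \<ge> 0"
    and ev: "mat_adjoint M * M *\<^sub>v v = complex_of_real (\<sigma>\<^sup>2) \<cdot>\<^sub>v v"
  shows "\<sigma> \<le> sigma_max M"
  unfolding sigma_max_def
proof (rule Max_ge[OF finite_singular_values])
  show "\<sigma> \<in> singular_values M"
    using v \<sigma> ev mat_adjoint_carrier[OF M] by (auto simp: singular_values_def eigenvalue_def eigenvector_def)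
qed

end

subsection \<open>The gain of a single mode\<close>

text \<open>The reciprocal square of the asserted norm, as a function of \<open>m = \<alpha> \<lambda>\<^sub>2\<close>. On a mode with
  eigenvalue \<open>m\<close> the squared gain at \<open>\<i> \<omega>\<close> is \<open>(1 + t) / ((m - t)\<^sup>2 + \<beta>\<^sup>2 t)\<close> with \<open>t = \<omega>\<^sup>2\<close>, whose
  maximum lies at \<open>1 + t = sqrt ((m + 1)\<^sup>2 - \<beta>\<^sup>2)\<close> or, if that is at most \<open>1\<close>, at \<open>t = 0\<close>.\<close>

definition gain_floor :: "real \<Rightarrow> real \<Rightarrow> real" where
  "gain_floor m \<beta> = (if \<beta> < sqrt (m\<^sup>2 + 2 * m) then m\<^sup>2 - (sqrt ((m + 1)\<^sup>2 - \<beta>\<^sup>2) - 1)\<^sup>2 else m\<^sup>2)"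

context
  fixes m \<beta> :: real
  assumes m: "m > 0" and \<beta>: "\<beta> > 0"
begin

text \<open>Write r for the square root. That r > 1 makes t = r - 1 a legitimate squared frequency;
  that r < m + 1 makes \<open>gain_floor\<close> positive and gives the right sign to the
  coefficient m + 1 - r below.\<close>

lemma resonance_sqrt:
  assumes "\<beta> < sqrt (m\<^sup>2 + 2 * m)"
  shows "(sqrt ((m + 1)\<^sup>2 - \<beta>\<^sup>2))\<^sup>2 = (m + 1)\<^sup>2 - \<beta>\<^sup>2"
    and "1 < sqrt ((m + 1)\<^sup>2 - \<beta>\<^sup>2)" and "sqrt ((m + 1)\<^sup>2 - \<beta>\<^sup>2) < m + 1"
proof -
  have "\<beta>\<^sup>2 < (sqrt (m\<^sup>2 + 2 * m))\<^sup>2"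
    using assms \<beta> by (intro power_strict_mono) auto
  then have b: "\<beta>\<^sup>2 < m\<^sup>2 + 2 * m" using m by simp
  then have gt: "(m + 1)\<^sup>2 - \<beta>\<^sup>2 > 1" by (simp add: power2_eq_square algebra_simps)
  then show "(sqrt ((m + 1)\<^sup>2 - \<beta>\<^sup>2))\<^sup>2 = (m + 1)\<^sup>2 - \<beta>\<^sup>2" by simp
  show "1 < sqrt ((m + 1)\<^sup>2 - \<beta>\<^sup>2)" using gt by simp
  show "sqrt ((m + 1)\<^sup>2 - \<beta>\<^sup>2) < m + 1"
    using m \<beta> by (intro real_less_lsqrt) auto
qed

lemma no_resonance: "\<not> \<beta> < sqrt (m\<^sup>2 + 2 * m) \<Longrightarrow> \<beta>\<^sup>2 \<ge> m\<^sup>2 + 2 * m"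
  using m \<beta> by (metis less_eq_real_def not_less real_le_lsqrt sqrt_le_D)

lemma gain_floor_pos: "gain_floor m \<beta> > 0"
proof (cases "\<beta> < sqrt (m\<^sup>2 + 2 * m)")
  case True
  have "(sqrt ((m + 1)\<^sup>2 - \<beta>\<^sup>2) - 1)\<^sup>2 < m\<^sup>2"
    using resonance_sqrt(2,3)[OF True] by (intro power_strict_mono) auto
  then show ?thesis using True by (simp add: gain_floor_def)
next
  case False
  then show ?thesis using m by (simp add: gain_floor_def)
qed

text \<open>The gain identity with denominators cleared. Once \<beta>^2 is replaced by (m + 1)^2 -
  r^2 it is polynomial in m and r, so no calculus is involved.\<close>

lemma gain_floor_attained:
  "\<exists>w. (m - w\<^sup>2)\<^sup>2 + \<beta>\<^sup>2 * w\<^sup>2 = gain_floor m \<beta> * (1 + w\<^sup>2)"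
proof (cases "\<beta> < sqrt (m\<^sup>2 + 2 * m)")
  case True
  define r where "r = sqrt ((m + 1)\<^sup>2 - \<beta>\<^sup>2)"
  note r = resonance_sqrt[OF True, folded r_def]
  have b: "\<beta>\<^sup>2 = (m + 1)\<^sup>2 - r\<^sup>2" using r by simp
  show ?thesis
  proof (rule exI[of _ "sqrt (r - 1)"])
    have t: "(sqrt (r - 1))\<^sup>2 = r - 1" using r by simp
    have G: "gain_floor m \<beta> = m\<^sup>2 - (r - 1)\<^sup>2" using True by (simp add: gain_floor_def r_def)
    show "(m - (sqrt (r - 1))\<^sup>2)\<^sup>2 + \<beta>\<^sup>2 * (sqrt (r - 1))\<^sup>2 = gain_floor m \<beta> * (1 + (sqrt (r - 1))\<^sup>2)"
      unfolding t b G by (simp add: power2_eq_square algebra_simps)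
  qed
next
  case False
  then show ?thesis by (intro exI[of _ 0]) (simp add: gain_floor_def)
qed

text \<open>Here \<open>a\<close>, \<open>b\<close>, \<open>c\<close> stand for \<open>|K p|\<^sup>2\<close>, \<open>\<langle>K p, p\<rangle>\<close>, \<open>|p|\<^sup>2\<close> with \<open>K = \<alpha> L\<close>, so that the hypotheses read
  \<open>|K p - k p|\<^sup>2 \<ge> 0\<close> and \<open>K \<ge> m\<close>. A suitable \<open>k\<close> reduces the claim to a multiple of \<open>K \<ge> m\<close>, which
  avoids diagonalising \<open>L\<close>.\<close>

lemma gain_floor_le:
  assumes sq: "\<And>k. a - 2 * k * b + k\<^sup>2 * c \<ge> 0" and b: "b \<ge> m * c" and c: "c \<ge> 0" and t: "t \<ge> 0"
  shows "gain_floor m \<beta> * (1 + t) * c \<le> a - 2 * t * b + (t\<^sup>2 + \<beta>\<^sup>2 * t) * c"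
proof (cases "\<beta> < sqrt (m\<^sup>2 + 2 * m)")
  case True
  define r where "r = sqrt ((m + 1)\<^sup>2 - \<beta>\<^sup>2)"
  note r = resonance_sqrt[OF True, folded r_def]
  have b2: "\<beta>\<^sup>2 = (m + 1)\<^sup>2 - r\<^sup>2" using r by simp
  have G: "gain_floor m \<beta> = m\<^sup>2 - (r - 1)\<^sup>2" using True by (simp add: gain_floor_def r_def)
  have "0 \<le> 2 * (m + 1 - r) * (b - m * c)" using r b by simp
  \<comment> \<open>With k = t + d the difference should be the square term plus 2 d (b - m c).
    Comparing powers of t forces d (2 m - d) = \<open>gain_floor m \<beta>\<close> and 2 d =
    \<beta>^2 - \<open>gain_floor m \<beta>\<close>, solved by d = m + 1 - r.\<close>
  moreover have "a - 2 * t * b + (t\<^sup>2 + \<beta>\<^sup>2 * t) * c - gain_floor m \<beta> * (1 + t) * c =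
    (a - 2 * (m + t + 1 - r) * b + (m + t + 1 - r)\<^sup>2 * c) + 2 * (m + 1 - r) * (b - m * c)"
    unfolding b2 G by (simp add: power2_eq_square algebra_simps)
  ultimately show ?thesis using sq[of "m + t + 1 - r"] by linarith
next
  case False
  have "0 \<le> 2 * m * (b - m * c)" using m b by simp
  moreover have "0 \<le> (\<beta>\<^sup>2 - (m\<^sup>2 + 2 * m)) * (t * c)" using no_resonance[OF False] t c by simp
  \<comment> \<open>Here d = m gives d (2 m - d) = m^2, and the surplus of \<beta>^2 over m^2 + 2 m
    remains as a nonnegative multiple of t c.\<close>
  moreover have "a - 2 * t * b + (t\<^sup>2 + \<beta>\<^sup>2 * t) * c - m\<^sup>2 * (1 + t) * c =
    (a - 2 * (m + t) * b + (m + t)\<^sup>2 * c) + 2 * m * (b - m * c) + (\<beta>\<^sup>2 - (m\<^sup>2 + 2 * m)) * (t * c)"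
    by (simp add: power2_eq_square algebra_simps)
  ultimately show ?thesis using sq[of "m + t"] False by (simp add: gain_floor_def)
qed

end

subsection \<open>The norm of the consensus system\<close>

context graph
begin

section \<open>The consensus projection and the system matrix\<close>

abbreviation "\<Phi> \<equiv> consensus_proj n"

lemma consensus_proj_sym: "i < n \<Longrightarrow> j < n \<Longrightarrow> \<Phi> $$ (i,j) = \<Phi> $$ (j,i)"
  by (simp add: consensus_proj_eq)

lemma consensus_proj_mult_vec:
  assumes "a \<in> carrier_vec n"
  shows "\<Phi> *\<^sub>v a = a - avg_mat n *\<^sub>v a"
  using assms by (simp add: consensus_proj_eq minus_mult_distrib_mat_vec[of _ n n])

lemma avg_consensus_proj: "avg_mat n * \<Phi> = 0\<^sub>m n n"
  unfolding consensus_proj_eq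
  using mult_minus_distrib_mat[of "avg_mat n" n n "1\<^sub>m n" n "avg_mat n"]
  by (auto simp: avg_mat_idem minus_carrier_mat intro!: eq_matI simp del: index_mult_mat(1))

lemma consensus_proj_idem: "\<Phi> * \<Phi> = \<Phi>"
proof -
  have "\<Phi> * \<Phi> = 1\<^sub>m n * \<Phi> - avg_mat n * \<Phi>"
    by (subst (1) consensus_proj_eq) (rule minus_mult_distrib_mat[of _ n n], auto)
  then show ?thesis by (auto simp: avg_consensus_proj intro!: eq_matI)
qed

text \<open>Pythagoras for an orthogonal projection: |a|^2 - |\<Phi> a|^2 = |a - \<Phi>
  a|^2.\<close>

lemma consensus_proj_contract:
  assumes a: "a \<in> carrier_vec n"
  shows "(\<Phi> *\<^sub>v a) \<bullet> (\<Phi> *\<^sub>v a) \<le> a \<bullet> a"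
proof -
  have Pa: "\<Phi> *\<^sub>v a \<in> carrier_vec n" using a by (rule mult_mat_vec_carrier[OF consensus_proj_carrier])
  have "\<Phi> *\<^sub>v (\<Phi> *\<^sub>v a) = \<Phi> *\<^sub>v a"
    using assoc_mult_mat_vec[OF consensus_proj_carrier consensus_proj_carrier a] by (simp add: consensus_proj_idem)
  then have 1: "(\<Phi> *\<^sub>v a) \<bullet> (\<Phi> *\<^sub>v a) = a \<bullet> (\<Phi> *\<^sub>v a)"
    using symmetric_quadratic_form[OF consensus_proj_carrier consensus_proj_sym a Pa] by simp
  have "0 \<le> (a - \<Phi> *\<^sub>v a) \<bullet> (a - \<Phi> *\<^sub>v a)" by (rule scalar_prod_self_nonneg)
  also have "\<dots> = a \<bullet> a - a \<bullet> (\<Phi> *\<^sub>v a)"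
    using a Pa 1 comm_scalar_prod[OF Pa a]
    by (simp add: scalar_prod_minus_distrib[of _ n] minus_scalar_prod_distrib[of _ n])
  finally show ?thesis using 1 by simp
qed

abbreviation "c\<Phi> \<equiv> map_mat complex_of_real \<Phi>"

lemma cnorm_sq_consensus_proj:
  assumes "u \<in> carrier_vec n"
  shows "cnorm_sq (c\<Phi> *\<^sub>v u) \<le> cnorm_sq u"
  using assms unfolding cnorm_sq_altdef
  by (simp add: Re_Im_of_real_mat_mult_vec[of _ n n] add_mono consensus_proj_contract)

lemma sys_mat_carrier [simp]: "sys_mat \<alpha> \<beta> z \<in> carrier_mat n n"
  and sys_mat_dim [simp]: "dim_row (sys_mat \<alpha> \<beta> z) = n" "dim_col (sys_mat \<alpha> \<beta> z) = n"
  by (simp_all add: sys_mat_def)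

lemma sys_mat_index:
  "i < n \<Longrightarrow> j < n \<Longrightarrow> sys_mat \<alpha> \<beta> z $$ (i,j) =
    complex_of_real (\<alpha> * L $$ (i,j) + 1 / real n) + (if i = j then z\<^sup>2 + complex_of_real \<beta> * z else 0)"
  by (simp add: sys_mat_def)

lemma sys_mat_adjoint: "mat_adjoint (sys_mat \<alpha> \<beta> z) = sys_mat \<alpha> \<beta> (cnj z)"
  using mat_adjoint_carrier[OF sys_mat_carrier[of \<alpha> \<beta> z]] sys_mat_carrier[of \<alpha> \<beta> "cnj z"]
  by (intro eq_matI) (auto simp: mat_adjoint_index[OF sys_mat_carrier] sys_mat_index laplacian_sym)

lemma add_avg_mat_avg: "(\<alpha> \<cdot>\<^sub>m L + avg_mat n) * avg_mat n = avg_mat n"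
  and avg_add_avg_mat: "avg_mat n * (\<alpha> \<cdot>\<^sub>m L + avg_mat n) = avg_mat n"
  using add_mult_distrib_mat[of "\<alpha> \<cdot>\<^sub>m L" n n "avg_mat n" "avg_mat n" n] mult_smult_assoc_mat[of L n n "avg_mat n" n \<alpha>]
    mult_add_distrib_mat[of "avg_mat n" n n "\<alpha> \<cdot>\<^sub>m L" n "avg_mat n"] mult_smult_distrib[of "avg_mat n" n n L n \<alpha>]
  by (simp_all add: laplacian_avg avg_laplacian avg_mat_idem)

lemma sys_mat_mult_vec:
  assumes "p \<in> carrier_vec n"
  shows "sys_mat \<alpha> \<beta> z *\<^sub>v p =
    map_mat complex_of_real (\<alpha> \<cdot>\<^sub>m L + avg_mat n) *\<^sub>v p + (z\<^sup>2 + complex_of_real \<beta> * z) \<cdot>\<^sub>v p"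
  using assms unfolding sys_mat_def
  by (simp add: add_mult_distrib_mat_vec[of _ n n] smult_mult_mat_vec[of _ n n])

text \<open>Both \<alpha> L and J commute with J, hence with \<Phi>. This allows estimates on the
  range of \<Phi> to be transferred to arbitrary vectors.\<close>

lemma sys_mat_consensus_proj: "sys_mat \<alpha> \<beta> z * c\<Phi> = c\<Phi> * sys_mat \<alpha> \<beta> z"
proof -
  let ?K = "\<alpha> \<cdot>\<^sub>m L + avg_mat n" and ?h = "map_mat complex_of_real" and ?c = "z\<^sup>2 + complex_of_real \<beta> * z"
  have K: "?K \<in> carrier_mat n n" by simp
  have KJ: "?K * avg_mat n = avg_mat n * ?K"
    by (simp only: add_avg_mat_avg avg_add_avg_mat)
  have "?K * \<Phi> = ?K * 1\<^sub>m n - ?K * avg_mat n"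
    unfolding consensus_proj_eq by (rule mult_minus_distrib_mat[of _ n n]) auto
  also have "\<dots> = 1\<^sub>m n * ?K - avg_mat n * ?K"
    unfolding KJ using K by simp
  also have "\<dots> = \<Phi> * ?K"
    unfolding consensus_proj_eq by (rule minus_mult_distrib_mat[symmetric, of _ n n]) auto
  finally have KP: "?h ?K * c\<Phi> = c\<Phi> * ?h ?K"
    using of_real_hom.mat_hom_mult[OF K consensus_proj_carrier] of_real_hom.mat_hom_mult[OF consensus_proj_carrier K] by metis
  have "sys_mat \<alpha> \<beta> z * c\<Phi> = ?h ?K * c\<Phi> + (?c \<cdot>\<^sub>m 1\<^sub>m n) * c\<Phi>"
    unfolding sys_mat_def by (rule add_mult_distrib_mat[of _ n n]) auto
  also have "(?c \<cdot>\<^sub>m 1\<^sub>m n) * c\<Phi> = c\<Phi> * (?c \<cdot>\<^sub>m 1\<^sub>m n)"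
    using mult_smult_assoc_mat[of "1\<^sub>m n" n n "c\<Phi>" n ?c] mult_smult_distrib[of "c\<Phi>" n n "1\<^sub>m n" n ?c]
      right_mult_one_mat[of "c\<Phi>" n n] left_mult_one_mat[of "c\<Phi>" n n] by simp
  also have "?h ?K * c\<Phi> + \<dots> = c\<Phi> * sys_mat \<alpha> \<beta> z"
    unfolding KP sys_mat_def by (rule mult_add_distrib_mat[symmetric, of _ n n]) auto
  finally show ?thesis .
qed

lemma out_mat_carrier [simp]: "out_mat z \<in> carrier_mat (n + n) n"
  unfolding out_mat_def by (rule carrier_append_rows) auto

lemma out_mat_mult_vec:
  assumes x: "x \<in> carrier_vec n"
  shows "out_mat z *\<^sub>v x = (c\<Phi> *\<^sub>v x) @\<^sub>v (z \<cdot>\<^sub>v (c\<Phi> *\<^sub>v x))"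
  using assms out_mat_carrier[of z]
  by (intro eq_vecI) (auto simp: out_mat_def scalar_prod_def append_rows_index sum_distrib_left mult.assoc intro!: sum.cong)

lemma out_mat_cscalar_prod:
  assumes x: "x \<in> carrier_vec n" and y: "y \<in> carrier_vec n"
  shows "(out_mat z *\<^sub>v x) \<bullet>c (out_mat z *\<^sub>v y) = (1 + z * cnj z) * ((c\<Phi> *\<^sub>v x) \<bullet>c (c\<Phi> *\<^sub>v y))"
proof -
  have c: "c\<Phi> *\<^sub>v u \<in> carrier_vec n" if "u \<in> carrier_vec n" for u
    using that by (intro mult_mat_vec_carrier[of _ n n]) auto
  have "conjugate (out_mat z *\<^sub>v y) = conjugate (c\<Phi> *\<^sub>v y) @\<^sub>v conjugate (z \<cdot>\<^sub>v (c\<Phi> *\<^sub>v y))"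
    unfolding out_mat_mult_vec[OF y] by (intro eq_vecI) auto
  then have "(out_mat z *\<^sub>v x) \<bullet>c (out_mat z *\<^sub>v y) =
      (c\<Phi> *\<^sub>v x) \<bullet>c (c\<Phi> *\<^sub>v y) + (z \<cdot>\<^sub>v (c\<Phi> *\<^sub>v x)) \<bullet>c (z \<cdot>\<^sub>v (c\<Phi> *\<^sub>v y))"
    using scalar_prod_append[of "c\<Phi> *\<^sub>v x" n "z \<cdot>\<^sub>v (c\<Phi> *\<^sub>v x)" n "conjugate (c\<Phi> *\<^sub>v y)"
        "conjugate (z \<cdot>\<^sub>v (c\<Phi> *\<^sub>v y))"] c[OF x] c[OF y]
    by (simp add: out_mat_mult_vec[OF x])
  then show ?thesis
    using c[OF x] c[OF y] by (simp add: conjugate_smult_vec algebra_simps)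
qed

lemma cnorm_sq_out_mat:
  assumes "x \<in> carrier_vec n"
  shows "cnorm_sq (out_mat (\<i> * complex_of_real w) *\<^sub>v x) = (1 + w\<^sup>2) * cnorm_sq (c\<Phi> *\<^sub>v x)"
  unfolding cnorm_sq_def out_mat_cscalar_prod[OF assms assms]
  by (simp add: power2_eq_square)

end

section \<open>Matching bounds on the imaginary axis\<close>

locale consensus_system = graph +
  fixes \<alpha> \<beta> lam2 :: real
  assumes n: "n \<ge> 2" and con: "connected_graph n W"
    and lam2: "lam2 = min_nonzero_eigenvalue L"
    and \<alpha>: "\<alpha> > 0" and \<beta>: "\<beta> > 0"
begin

abbreviation "m \<equiv> \<alpha> * lam2"

lemma m_pos: "m > 0"
  using algebraic_connectivity_pos[OF n con] \<alpha> by (simp add: lam2)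

text \<open>On such p the term J drops out and the system matrix acts as \<alpha> L - w^2 + i
  \<beta> w. The forms A, B, C, summed over real and imaginary parts, meet the hypotheses of
  \<open>gain_floor_le\<close> with t = w^2.\<close>

lemma sys_mat_lower_bound_range:
  assumes p: "p \<in> carrier_vec n"
    and avg: "avg_mat n *\<^sub>v map_vec Re p = 0\<^sub>v n" "avg_mat n *\<^sub>v map_vec Im p = 0\<^sub>v n"
  shows "gain_floor m \<beta> * (1 + w\<^sup>2) * cnorm_sq p \<le> cnorm_sq (sys_mat \<alpha> \<beta> (\<i> * complex_of_real w) *\<^sub>v p)"
proof -
  let ?D = "sys_mat \<alpha> \<beta> (\<i> * complex_of_real w)"
  define a b where "a = map_vec Re p" and "b = map_vec Im p"
  have a: "a \<in> carrier_vec n" and b: "b \<in> carrier_vec n" using p by (simp_all add: a_def b_def)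
  have La: "L *\<^sub>v a \<in> carrier_vec n" and Lb: "L *\<^sub>v b \<in> carrier_vec n"
    using mult_mat_vec_carrier[OF laplacian_carrier] a b by auto
  have K: "(\<alpha> \<cdot>\<^sub>m L + avg_mat n) *\<^sub>v x = \<alpha> \<cdot>\<^sub>v (L *\<^sub>v x)"
    if "x \<in> carrier_vec n" "avg_mat n *\<^sub>v x = 0\<^sub>v n" for x
    using that mult_mat_vec_carrier[OF laplacian_carrier that(1)]
    by (simp add: add_mult_distrib_mat_vec[of _ n n] smult_mult_mat_vec[of _ n n])
  have Dp: "?D *\<^sub>v p = map_mat complex_of_real (\<alpha> \<cdot>\<^sub>m L + avg_mat n) *\<^sub>v p
      + Complex (- w\<^sup>2) (\<beta> * w) \<cdot>\<^sub>v p"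
  proof -
    have "(\<i> * complex_of_real w)\<^sup>2 + complex_of_real \<beta> * (\<i> * complex_of_real w) = Complex (- w\<^sup>2) (\<beta> * w)"
      by (simp add: complex_eq_iff power2_eq_square)
    then show ?thesis unfolding sys_mat_mult_vec[OF p] by simp
  qed
  have Re_Im: "map_vec Re (x + c \<cdot>\<^sub>v p) = map_vec Re x + (Re c \<cdot>\<^sub>v a - Im c \<cdot>\<^sub>v b)"
      "map_vec Im (x + c \<cdot>\<^sub>v p) = map_vec Im x + (Re c \<cdot>\<^sub>v b + Im c \<cdot>\<^sub>v a)" if "x \<in> carrier_vec n" for x c
    using that p by (auto simp: a_def b_def intro!: eq_vecI)
  have Kp: "map_mat complex_of_real (\<alpha> \<cdot>\<^sub>m L + avg_mat n) *\<^sub>v p \<in> carrier_vec n"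
    using p by (intro mult_mat_vec_carrier[of _ n n]) auto
  have re: "map_vec Re (?D *\<^sub>v p) = \<alpha> \<cdot>\<^sub>v (L *\<^sub>v a) + ((- w\<^sup>2) \<cdot>\<^sub>v a - (\<beta> * w) \<cdot>\<^sub>v b)"
    and im: "map_vec Im (?D *\<^sub>v p) = \<alpha> \<cdot>\<^sub>v (L *\<^sub>v b) + ((- w\<^sup>2) \<cdot>\<^sub>v b + (\<beta> * w) \<cdot>\<^sub>v a)"
    unfolding Dp Re_Im[OF Kp] using p avg K[OF a] K[OF b]
    by (simp_all add: Re_Im_of_real_mat_mult_vec[of _ n n] a_def[symmetric] b_def[symmetric])
  have LL: "(L *\<^sub>v b) \<bullet> a = (L *\<^sub>v a) \<bullet> b"
    using symmetric_quadratic_form[OF laplacian_carrier laplacian_sym a b] a b La Lb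
    by (simp add: comm_scalar_prod[of _ n])
  define A where "A = \<alpha>\<^sup>2 * ((L *\<^sub>v a) \<bullet> (L *\<^sub>v a) + (L *\<^sub>v b) \<bullet> (L *\<^sub>v b))"
  define B where "B = \<alpha> * ((L *\<^sub>v a) \<bullet> a + (L *\<^sub>v b) \<bullet> b)"
  define C where "C = a \<bullet> a + b \<bullet> b"
  have swap: "a \<bullet> (L *\<^sub>v a) = (L *\<^sub>v a) \<bullet> a" "b \<bullet> (L *\<^sub>v b) = (L *\<^sub>v b) \<bullet> b" "a \<bullet> (L *\<^sub>v b) = (L *\<^sub>v a) \<bullet> b"
      "b \<bullet> (L *\<^sub>v a) = (L *\<^sub>v a) \<bullet> b" "b \<bullet> a = a \<bullet> b"
    using a b La Lb LL comm_scalar_prod[of _ n] by metis+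
  \<comment> \<open>The damping term i \<beta> w couples a and b, but the mixed terms cancel because
    L is symmetric.\<close>
  have norm_D: "cnorm_sq (?D *\<^sub>v p) = A - 2 * w\<^sup>2 * B + ((w\<^sup>2)\<^sup>2 + \<beta>\<^sup>2 * w\<^sup>2) * C"
    unfolding cnorm_sq_altdef re im A_def B_def C_def using a b La Lb
    by (simp add: scalar_prod_add_distrib[of _ n] add_scalar_prod_distrib[of _ n]
        scalar_prod_minus_distrib[of _ n] minus_scalar_prod_distrib[of _ n] swap LL power2_eq_square algebra_simps)
  have sq: "A - 2 * k * B + k\<^sup>2 * C \<ge> 0" for k
  proof -
    have "0 \<le> (\<alpha> \<cdot>\<^sub>v (L *\<^sub>v a) - k \<cdot>\<^sub>v a) \<bullet> (\<alpha> \<cdot>\<^sub>v (L *\<^sub>v a) - k \<cdot>\<^sub>v a)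
        + (\<alpha> \<cdot>\<^sub>v (L *\<^sub>v b) - k \<cdot>\<^sub>v b) \<bullet> (\<alpha> \<cdot>\<^sub>v (L *\<^sub>v b) - k \<cdot>\<^sub>v b)"
      by (intro add_nonneg_nonneg scalar_prod_self_nonneg)
    also have "\<dots> = A - 2 * k * B + k\<^sup>2 * C"
      unfolding A_def B_def C_def using a b La Lb
      by (simp add: scalar_prod_minus_distrib[of _ n] minus_scalar_prod_distrib[of _ n] swap power2_eq_square algebra_simps)
    finally show ?thesis .
  qed
  have "lam2 * (a \<bullet> a) \<le> a \<bullet> (L *\<^sub>v a)" "lam2 * (b \<bullet> b) \<le> b \<bullet> (L *\<^sub>v b)"
    using algebraic_connectivity_gap[OF n con] a b avg by (simp_all add: lam2 a_def b_def)
  then have "lam2 * C \<le> (L *\<^sub>v a) \<bullet> a + (L *\<^sub>v b) \<bullet> b"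
    by (simp add: C_def swap distrib_left)
  then have "m * C \<le> B"
    using \<alpha> by (simp add: B_def mult.assoc)
  moreover have "C \<ge> 0"
    by (simp add: C_def scalar_prod_self_nonneg)
  moreover have "cnorm_sq p = C"
    by (simp add: cnorm_sq_altdef C_def a_def b_def)
  ultimately show ?thesis
    unfolding norm_D using gain_floor_le[OF m_pos \<beta> sq, of "w\<^sup>2"] by simp
qed

lemma sys_mat_lower_bound:
  assumes q: "q \<in> carrier_vec n"
  shows "gain_floor m \<beta> * (1 + w\<^sup>2) * cnorm_sq (c\<Phi> *\<^sub>v q) \<le> cnorm_sq (sys_mat \<alpha> \<beta> (\<i> * complex_of_real w) *\<^sub>v q)"
proof -
  let ?D = "sys_mat \<alpha> \<beta> (\<i> * complex_of_real w)"
  have cP: "c\<Phi> \<in> carrier_mat n n" by simp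
  have p: "c\<Phi> *\<^sub>v q \<in> carrier_vec n" using cP q by (rule mult_mat_vec_carrier)
  have "avg_mat n *\<^sub>v (\<Phi> *\<^sub>v x) = 0\<^sub>v n" if "x \<in> carrier_vec n" for x
    using assoc_mult_mat_vec[OF avg_mat_carrier consensus_proj_carrier that] that by (simp add: avg_consensus_proj)
  then have "gain_floor m \<beta> * (1 + w\<^sup>2) * cnorm_sq (c\<Phi> *\<^sub>v q) \<le> cnorm_sq (?D *\<^sub>v (c\<Phi> *\<^sub>v q))"
    using q by (intro sys_mat_lower_bound_range p) (simp_all add: Re_Im_of_real_mat_mult_vec[of _ n n])
  also have "?D *\<^sub>v (c\<Phi> *\<^sub>v q) = c\<Phi> *\<^sub>v (?D *\<^sub>v q)"
    using assoc_mult_mat_vec[OF sys_mat_carrier cP q] assoc_mult_mat_vec[OF cP sys_mat_carrier q]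
    by (simp add: sys_mat_consensus_proj)
  also have "cnorm_sq \<dots> \<le> cnorm_sq (?D *\<^sub>v q)"
    by (intro cnorm_sq_consensus_proj mult_mat_vec_carrier[OF sys_mat_carrier q])
  finally show ?thesis .
qed

text \<open>The lower bound forces \<Phi> q = 0 for a kernel vector q, so q is constant; on
  constants the matrix is multiplication by 1 + z^2 + \<beta> z at z = i w.\<close>

lemma det_sys_mat: "det (sys_mat \<alpha> \<beta> (\<i> * complex_of_real w)) \<noteq> 0"
proof
  let ?D = "sys_mat \<alpha> \<beta> (\<i> * complex_of_real w)" and ?K = "\<alpha> \<cdot>\<^sub>m L + avg_mat n"
  let ?h = "map_mat complex_of_real" and ?c = "(\<i> * complex_of_real w)\<^sup>2 + complex_of_real \<beta> * (\<i> * complex_of_real w)"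
  assume "det ?D = 0"
  then obtain q where q: "q \<in> carrier_vec n" "q \<noteq> 0\<^sub>v n" "?D *\<^sub>v q = 0\<^sub>v n"
    using det_0_iff_vec_prod_zero[OF sys_mat_carrier] by auto
  have p: "c\<Phi> *\<^sub>v q \<in> carrier_vec n" using q(1) by (intro mult_mat_vec_carrier[of _ n n]) auto
  have "gain_floor m \<beta> * (1 + w\<^sup>2) * cnorm_sq (c\<Phi> *\<^sub>v q) \<le> 0"
    using sys_mat_lower_bound[OF q(1), of w] q(3) by (simp add: cnorm_sq_def)
  moreover have "gain_floor m \<beta> * (1 + w\<^sup>2) > 0"
    using gain_floor_pos[OF m_pos \<beta>] by (intro mult_pos_pos) (auto simp: add_pos_nonneg)
  ultimately have "cnorm_sq (c\<Phi> *\<^sub>v q) = 0"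
    using cnorm_sq_nonneg[of "c\<Phi> *\<^sub>v q"] by (smt (verit) mult_pos_pos)
  then have "c\<Phi> *\<^sub>v q = 0\<^sub>v n" by (rule cnorm_sq_eq_0[OF p])
  moreover have "c\<Phi> = 1\<^sub>m n - ?h (avg_mat n)"
    by (intro eq_matI) (auto simp: consensus_proj_eq)
  ultimately have qJ: "q - ?h (avg_mat n) *\<^sub>v q = 0\<^sub>v n"
    using q(1) by (simp add: minus_mult_distrib_mat_vec[of _ n n])
  have q_const: "?h (avg_mat n) *\<^sub>v q = q"
  proof (rule eq_vecI)
    fix i assume "i < dim_vec q"
    then show "(?h (avg_mat n) *\<^sub>v q) $ i = q $ i"
      using arg_cong[OF qJ, of "\<lambda>u. u $ i"] q(1) by (simp del: index_mult_mat_vec)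
  qed (use q in auto)
  have "?h ?K *\<^sub>v q = ?h ?K *\<^sub>v (?h (avg_mat n) *\<^sub>v q)" by (simp only: q_const)
  also have "\<dots> = ?h (?K * avg_mat n) *\<^sub>v q"
  proof -
    have "?h ?K * ?h (avg_mat n) *\<^sub>v q = ?h ?K *\<^sub>v (?h (avg_mat n) *\<^sub>v q)"
      using q(1) by (intro assoc_mult_mat_vec[of _ n n _ n]) auto
    moreover have "?h (?K * avg_mat n) = ?h ?K * ?h (avg_mat n)"
      by (intro of_real_hom.mat_hom_mult[of _ n n _ n]) auto
    ultimately show ?thesis by metis
  qed
  finally have "?D *\<^sub>v q = q + ?c \<cdot>\<^sub>v q"
    unfolding sys_mat_mult_vec[OF q(1)] add_avg_mat_avg q_const by simp
  then have z: "q + ?c \<cdot>\<^sub>v q = 0\<^sub>v n" using q(3) by simp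
  \<comment> \<open>The imaginary part \<beta> w vanishes only at w = 0, where the value is
    1.\<close>
  have "1 + ?c \<noteq> 0"
    using \<beta> by (auto simp: complex_eq_iff power2_eq_square)
  moreover have "(1 + ?c) * q $ i = 0" if "i < n" for i
    using arg_cong[OF z, of "\<lambda>u. u $ i"] that q(1) by (simp add: distrib_right)
  ultimately have "q = 0\<^sub>v n" using q(1) by (intro eq_vecI) auto
  then show False using q by simp
qed

lemma eval_T1_carrier: "eval_tf (T1 n W \<alpha> \<beta>) z \<in> carrier_mat (n + n) n"
  using T1_times_sys_mat(1) by (simp add: eval_tf_def)

text \<open>Every input can be written as u = \<open>sys_mat\<close> q, and its output is then
  \<open>out_mat\<close> q. Parametrising inputs by q keeps the inverse of the system matrix out of
  the estimates.\<close>

lemma T1_mult_vec: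
  assumes q: "q \<in> carrier_vec n"
  shows "eval_tf (T1 n W \<alpha> \<beta>) (\<i> * complex_of_real w) *\<^sub>v (sys_mat \<alpha> \<beta> (\<i> * complex_of_real w) *\<^sub>v q)
    = out_mat (\<i> * complex_of_real w) *\<^sub>v q"
  using assoc_mult_mat_vec[OF eval_T1_carrier sys_mat_carrier q] eval_T1[OF det_sys_mat] by metis

lemma sys_mat_surj:
  assumes "u \<in> carrier_vec n"
  obtains q where "q \<in> carrier_vec n" "sys_mat \<alpha> \<beta> (\<i> * complex_of_real w) *\<^sub>v q = u"
proof -
  let ?D = "sys_mat \<alpha> \<beta> (\<i> * complex_of_real w)"
  obtain E where E: "E \<in> carrier_mat n n" "?D * E = 1\<^sub>m n"
    using det_nonzero_inverse[OF sys_mat_carrier det_sys_mat] by blast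
  show ?thesis
  proof (rule that[of "E *\<^sub>v u"])
    show "E *\<^sub>v u \<in> carrier_vec n" using E(1) assms by (rule mult_mat_vec_carrier)
    show "?D *\<^sub>v (E *\<^sub>v u) = u"
      using assoc_mult_mat_vec[OF sys_mat_carrier E(1) assms, of \<alpha> \<beta> "\<i> * complex_of_real w"] E(2) assms by simp
  qed
qed

lemma sigma_max_T1_le:
  "sigma_max (eval_tf (T1 n W \<alpha> \<beta>) (\<i> * complex_of_real w)) \<le> 1 / sqrt (gain_floor m \<beta>)"
proof (rule sigma_max_le[OF eval_T1_carrier])
  let ?G = "gain_floor m \<beta>"
  have G: "?G > 0" by (rule gain_floor_pos[OF m_pos \<beta>])
  show "n > 0" using n by simp
  show "0 \<le> 1 / sqrt ?G" using G by simp
  fix u :: "complex vec" assume "u \<in> carrier_vec n"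
  then obtain q where q: "q \<in> carrier_vec n" "sys_mat \<alpha> \<beta> (\<i> * complex_of_real w) *\<^sub>v q = u"
    by (rule sys_mat_surj)
  have "?G * ((1 + w\<^sup>2) * cnorm_sq (c\<Phi> *\<^sub>v q)) \<le> cnorm_sq u"
    using sys_mat_lower_bound[OF q(1), of w] q(2) by (simp add: mult.assoc)
  then have "(1 + w\<^sup>2) * cnorm_sq (c\<Phi> *\<^sub>v q) \<le> (1 / sqrt ?G)\<^sup>2 * cnorm_sq u"
    using G by (simp add: power_divide field_simps)
  then show "cnorm_sq (eval_tf (T1 n W \<alpha> \<beta>) (\<i> * complex_of_real w) *\<^sub>v u) \<le> (1 / sqrt ?G)\<^sup>2 * cnorm_sq u"
    using T1_mult_vec[OF q(1), of w] q(2) cnorm_sq_out_mat[OF q(1), of w] by simp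
qed

text \<open>An eigenvector of L for lam2, complexified; J annihilates it, so it serves all z at
  once. The same vector is needed at both z and \<open>cnj z\<close>.\<close>

lemma sys_mat_eigenvector:
  obtains v where "v \<in> carrier_vec n" "v \<noteq> 0\<^sub>v n" "c\<Phi> *\<^sub>v v = v"
    "\<forall>z. sys_mat \<alpha> \<beta> z *\<^sub>v v = (complex_of_real m + z\<^sup>2 + complex_of_real \<beta> * z) \<cdot>\<^sub>v v"
proof -
  let ?h = "map_mat complex_of_real"
  obtain x where ev: "eigenvector L x lam2"
    using algebraic_connectivity_eigenvalue[OF n con] by (auto simp: lam2 eigenvalue_def)
  then have x: "x \<in> carrier_vec n" "x \<noteq> 0\<^sub>v n" "L *\<^sub>v x = lam2 \<cdot>\<^sub>v x"
    using laplacian_carrier by (auto simp: eigenvector_def)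
  have lam2_0: "lam2 \<noteq> 0" using algebraic_connectivity_pos[OF n con] by (simp add: lam2)
  have Jx: "avg_mat n *\<^sub>v x = 0\<^sub>v n" by (rule laplacian_eigenvector_avg[OF ev lam2_0])
  let ?v = "map_vec complex_of_real x"
  have v: "?v \<in> carrier_vec n" using x by simp
  show thesis
  proof (rule that[OF v])
    show "?v \<noteq> 0\<^sub>v n"
    proof
      assume "?v = 0\<^sub>v n"
      then have "x $ i = 0" if "i < n" for i
        using arg_cong[of ?v "0\<^sub>v n" "\<lambda>u. u $ i"] that x(1) by simp
      then show False using x(1,2) by (auto intro!: eq_vecI)
    qed
    have "\<Phi> *\<^sub>v x = x" using x(1) by (simp add: consensus_proj_mult_vec Jx)
    then show "c\<Phi> *\<^sub>v ?v = ?v"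
      using of_real_hom.mult_mat_vec_hom[OF consensus_proj_carrier x(1)] by metis
    have "(\<alpha> \<cdot>\<^sub>m L + avg_mat n) *\<^sub>v x = m \<cdot>\<^sub>v x"
      using x by (simp add: add_mult_distrib_mat_vec[of _ n n] smult_mult_mat_vec[of _ n n] Jx smult_smult_assoc)
    moreover have "map_vec complex_of_real (m \<cdot>\<^sub>v x) = complex_of_real m \<cdot>\<^sub>v ?v"
      by (intro eq_vecI) auto
    moreover have "\<alpha> \<cdot>\<^sub>m L + avg_mat n \<in> carrier_mat n n" by simp
    ultimately have "?h (\<alpha> \<cdot>\<^sub>m L + avg_mat n) *\<^sub>v ?v = complex_of_real m \<cdot>\<^sub>v ?v"
      using of_real_hom.mult_mat_vec_hom[of "\<alpha> \<cdot>\<^sub>m L + avg_mat n" n n x] x(1) by metis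
    then show "\<forall>z. sys_mat \<alpha> \<beta> z *\<^sub>v ?v = (complex_of_real m + z\<^sup>2 + complex_of_real \<beta> * z) \<cdot>\<^sub>v ?v"
      unfolding sys_mat_mult_vec[OF v] by (auto intro!: eq_vecI simp: algebra_simps)
  qed
qed

lemma sigma_max_T1_ge:
  defines "d \<equiv> \<lambda>w. (m - w\<^sup>2)\<^sup>2 + \<beta>\<^sup>2 * w\<^sup>2"
  shows "sqrt ((1 + w\<^sup>2) / d w) \<le> sigma_max (eval_tf (T1 n W \<alpha> \<beta>) (\<i> * complex_of_real w))"
proof -
  let ?z = "\<i> * complex_of_real w"
  let ?M = "eval_tf (T1 n W \<alpha> \<beta>) ?z" and ?D = "sys_mat \<alpha> \<beta> ?z"
  obtain v where v: "v \<in> carrier_vec n" "v \<noteq> 0\<^sub>v n" "c\<Phi> *\<^sub>v v = v"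
    and Dv_all: "\<forall>z. sys_mat \<alpha> \<beta> z *\<^sub>v v = (complex_of_real m + z\<^sup>2 + complex_of_real \<beta> * z) \<cdot>\<^sub>v v"
    by (rule sys_mat_eigenvector)
  note Dv = Dv_all[rule_format]
  define e where "e = complex_of_real m + ?z\<^sup>2 + complex_of_real \<beta> * ?z"
  have e_cnj: "complex_of_real m + (cnj ?z)\<^sup>2 + complex_of_real \<beta> * cnj ?z = cnj e"
    by (simp add: e_def)
  have ee: "e * cnj e = complex_of_real (d w)"
    by (simp add: e_def d_def complex_eq_iff power2_eq_square algebra_simps)
  have d: "d w > 0"
  proof (cases "w = 0")
    case True
    then show ?thesis using m_pos \<alpha> by (auto simp: d_def zero_less_mult_iff)
  next
    case False
    then show ?thesis using \<beta> by (simp add: d_def add_nonneg_pos)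
  qed
  have e0: "e \<noteq> 0" using ee d by auto
  let ?k = "complex_of_real ((1 + w\<^sup>2) / d w)"
  have Mv: "?M *\<^sub>v v \<in> carrier_vec (n + n)" using eval_T1_carrier v(1) by (rule mult_mat_vec_carrier)
  have "e \<cdot>\<^sub>v (?M *\<^sub>v v) = ?M *\<^sub>v (?D *\<^sub>v v)"
    unfolding Dv e_def by (rule mult_mat_vec[OF eval_T1_carrier v(1), symmetric])
  also have "\<dots> = out_mat ?z *\<^sub>v v" by (rule T1_mult_vec[OF v(1)])
  finally have eMv: "e \<cdot>\<^sub>v (?M *\<^sub>v v) = out_mat ?z *\<^sub>v v" .
  let ?g = "mat_adjoint ?M *\<^sub>v (?M *\<^sub>v v)"
  have g: "?g \<in> carrier_vec n"
    using mat_adjoint_carrier[OF eval_T1_carrier] Mv by (rule mult_mat_vec_carrier)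
  \<comment> \<open>The adjoint of T is never computed: y is written as
    \<open>?D *\<^sub>v q\<close>, and both inner products are expressed through that of v and q.
    One carries the factor e and the other \<open>cnj e\<close>, whose product is
    \<open>d w\<close>.\<close>
  have gy: "?g \<bullet>c y = ?k * (v \<bullet>c y)" if y: "y \<in> carrier_vec n" for y
  proof -
    obtain q where q: "q \<in> carrier_vec n" "?D *\<^sub>v q = y"
      using y by (rule sys_mat_surj)
    have My: "?M *\<^sub>v y = out_mat ?z *\<^sub>v q" using T1_mult_vec[OF q(1), of w] q(2) by simp
    have Oq: "out_mat ?z *\<^sub>v q \<in> carrier_vec (n + n)"
      using out_mat_carrier q(1) by (rule mult_mat_vec_carrier)
    have Pq: "c\<Phi> *\<^sub>v q \<in> carrier_vec n" using q(1) by (intro mult_mat_vec_carrier[of _ n n]) auto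
    have adj: "mat_adjoint c\<Phi> = c\<Phi>"
      using mat_adjoint_carrier[of "c\<Phi>" n n]
      by (intro eq_matI) (auto simp: mat_adjoint_index[of _ n n] consensus_proj_sym)
    have "e * (?g \<bullet>c y) = e * ((?M *\<^sub>v v) \<bullet>c (out_mat ?z *\<^sub>v q))"
      using mat_adjoint_cscalar_prod[OF eval_T1_carrier Mv y] by (simp only: My)
    also have "\<dots> = (e \<cdot>\<^sub>v (?M *\<^sub>v v)) \<bullet>c (out_mat ?z *\<^sub>v q)"
      using Mv Oq by simp
    also have "\<dots> = complex_of_real (1 + w\<^sup>2) * ((c\<Phi> *\<^sub>v v) \<bullet>c (c\<Phi> *\<^sub>v q))"
    proof -
      have "1 + ?z * cnj ?z = complex_of_real (1 + w\<^sup>2)"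
        by (simp add: complex_eq_iff power2_eq_square)
      then show ?thesis
        unfolding eMv using out_mat_cscalar_prod[OF v(1) q(1), of ?z] by metis
    qed
    also have "(c\<Phi> *\<^sub>v v) \<bullet>c (c\<Phi> *\<^sub>v q) = (mat_adjoint c\<Phi> *\<^sub>v (c\<Phi> *\<^sub>v v)) \<bullet>c q"
      using v q by (intro mat_adjoint_cscalar_prod[symmetric, of _ n n]) auto
    also have "\<dots> = v \<bullet>c q" by (simp only: adj v(3))
    finally have 1: "e * (?g \<bullet>c y) = complex_of_real (1 + w\<^sup>2) * (v \<bullet>c q)" .
    have "v \<bullet>c y = (mat_adjoint ?D *\<^sub>v v) \<bullet>c q"
      using mat_adjoint_cscalar_prod[OF sys_mat_carrier v(1) q(1)] q(2) by simp
    also have "\<dots> = (cnj e \<cdot>\<^sub>v v) \<bullet>c q"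
      unfolding sys_mat_adjoint Dv e_cnj ..
    also have "\<dots> = cnj e * (v \<bullet>c q)" using v q by simp
    finally have 2: "v \<bullet>c y = cnj e * (v \<bullet>c q)" .
    have "complex_of_real (d w) * (?g \<bullet>c y) = cnj e * (e * (?g \<bullet>c y))"
      unfolding ee[symmetric] by (simp only: mult_ac)
    also have "\<dots> = complex_of_real (1 + w\<^sup>2) * (v \<bullet>c y)"
      unfolding 1 2 by (simp only: mult_ac)
    finally show ?thesis using d by (simp add: field_simps)
  qed
  \<comment> \<open>The residual of the eigenvector equation is orthogonal to every vector, hence to
    itself.\<close>
  let ?r = "?g - ?k \<cdot>\<^sub>v v"
  have r: "?r \<in> carrier_vec n" using g v by simp
  have "?r \<bullet>c ?r = ?g \<bullet>c ?r - ?k * (v \<bullet>c ?r)"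
    using g v(1) r by (subst minus_scalar_prod_distrib[of _ n]) auto
  then have "?r \<bullet>c ?r = 0" using gy[OF r] by simp
  then have r0: "?r = 0\<^sub>v n" using conjugate_square_eq_0_vec[OF r] by simp
  have "?g = ?k \<cdot>\<^sub>v v"
  proof (rule eq_vecI)
    fix i assume "i < dim_vec (?k \<cdot>\<^sub>v v)"
    then show "?g $ i = (?k \<cdot>\<^sub>v v) $ i"
      using arg_cong[OF r0, of "\<lambda>u. u $ i"] g v(1) by (simp del: index_mult_mat_vec)
  qed (use carrier_vecD[OF g] v in auto)
  moreover have "(sqrt ((1 + w\<^sup>2) / d w))\<^sup>2 = (1 + w\<^sup>2) / d w"
    using d by simp
  ultimately show ?thesis
    using gram_mult_vec[OF eval_T1_carrier v(1)] d by (intro sigma_max_ge[OF eval_T1_carrier v(1,2)]) auto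
qed

lemma hinf_norm_T1: "hinf_norm (T1 n W \<alpha> \<beta>) = ereal (1 / sqrt (gain_floor m \<beta>))"
proof (rule antisym)
  show "hinf_norm (T1 n W \<alpha> \<beta>) \<le> ereal (1 / sqrt (gain_floor m \<beta>))"
    unfolding hinf_norm_def by (intro SUP_least) (simp add: sigma_max_T1_le)
  obtain w where w: "(m - w\<^sup>2)\<^sup>2 + \<beta>\<^sup>2 * w\<^sup>2 = gain_floor m \<beta> * (1 + w\<^sup>2)"
    using gain_floor_attained[OF m_pos \<beta>] by blast
  have "1 + w\<^sup>2 > 0" by (simp add: add_pos_nonneg)
  then have "1 / sqrt (gain_floor m \<beta>) = sqrt ((1 + w\<^sup>2) / ((m - w\<^sup>2)\<^sup>2 + \<beta>\<^sup>2 * w\<^sup>2))"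
    unfolding w by (simp add: real_sqrt_divide real_sqrt_mult)
  also have "\<dots> \<le> sigma_max (eval_tf (T1 n W \<alpha> \<beta>) (\<i> * complex_of_real w))"
    by (rule sigma_max_T1_ge)
  finally show "ereal (1 / sqrt (gain_floor m \<beta>)) \<le> hinf_norm (T1 n W \<alpha> \<beta>)"
    unfolding hinf_norm_def by (intro SUP_upper2[of w]) auto
qed

end

theorem theorem1:
  fixes n :: nat and W :: "real mat" and \<alpha> \<beta> lam2 :: real
  assumes "n \<ge> 2"
    and "weighted_graph n W"
    and "connected_graph n W"
    and "lam2 = min_nonzero_eigenvalue (laplacian n W)"
    and "\<alpha> > 0"
    and "\<beta> > 0"
  shows "hinf_norm (T1 n W \<alpha> \<beta>) = ereal
    (if \<beta> < sqrt ((\<alpha> * lam2)\<^sup>2 + 2 * \<alpha> * lam2)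
     then 1 / sqrt ((\<alpha> * lam2)\<^sup>2 - (sqrt ((\<alpha> * lam2 + 1)\<^sup>2 - \<beta>\<^sup>2) - 1)\<^sup>2)
     else 1 / (\<alpha> * lam2))"
proof -
  interpret consensus_system n W \<alpha> \<beta> lam2
    using assms by unfold_locales auto
  \<comment> \<open>In the second case \<open>gain_floor\<close> is m^2, and positivity of m turns
    its square root into m.\<close>
  show ?thesis
    unfolding hinf_norm_T1 using m_pos by (simp add: gain_floor_def mult.assoc)
qed

end
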